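(* Let $0<q<1$, $\alpha\in\mathbb{R}\setminus[-1,1]$, $\lambda>0$, $j\in\mathbb{N}$, and let $\{\mathbb{H}_n(x;q)\}_{n\ge 0}$ be the sequence of $q$-Hermite I-Sobolev type polynomials. Then $$\mathcal{R}_n(x)\,D_q^2\mathbb{H}_n(x;q)+\mathcal{S}_n(x)\,D_q\mathbb{H}_n(x;q)+\mathcal{T}_n(x)\,\mathbb{H}_n(x;q)=0,\qquad n\ge 0,$$ where $$\mathcal{R}_n(x)=\mathcal{F}_{4,n}(x)\,\Xi_{1,n}(x),\qquad \mathcal{S}_n(x)=-\mathcal{F}_{6,n}(x)\,\Xi_{1,n}(x),$$ $$\mathcal{T}_n(x)=\mathcal{E}_{4,n}(x)\mathcal{F}_{6,n}(x)-\mathcal{E}_{6,n}(x)\mathcal{F}_{4,n}(x).$$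
   Context: Here $\mathbb{N}=\{0,1,2,\dots\}$ and $0<q<1$. Notation: $[n]_q=\frac{1-q^n}{1-q}$ for $n\in\mathbb{Z}$, $[0]_q!=1$, $[n]_q!=[n]_q\cdots[1]_q$; $(a;q)_n=\prod_{i=0}^{n-1}(1-aq^i)$ (also for $n=\infty$), $(a_1,\dots,a_r;q)_n=\prod_i(a_i;q)_n$; $[n]_q^{(k)}=\frac{(q^{-n};q)_k}{(q-1)^k}q^{kn-\binom{k}{2}}$. The $q$-derivative is $D_qf(x)=\frac{f(qx)-f(x)}{(q-1)x}$ for $x\ne0$ (and $f'(0)$ at $x=0$), $D_q^0f=f$, $D_q^k=D_q D_q^{k-1}$. The $q$-subtraction power is $(x\boxminus_q y)^m=\sum_{k=0}^m\frac{[m]_q!}{[k]_q![m-k]_q!}q^{\binom{k}{2}}(-y)^kx^{m-k}$. Monic $q$-Hermite I polynomials: $H_n(x;q)=q^{\binom n2}\sum_{k=0}^n\frac{(q^{-n};q)_k(x^{-1};q)_k}{(q;q)_k}(-qx)^k$ for $n\ge0$, and $H_m=0$ for $m<0$; they satisfy $xH_n=H_{n+1}+\gamma_nH_{n-1}$ with $\gamma_n=q^{n-1}(1-q^n)$. Put $\|H_n\|^2=(1-q)(q;q)_n(q,-1,-q;q)_\infty q^{\binom n2}$ and $K_{n,q}^{(i,l)}(x,y)=\sum_{k=0}^n\frac{(D_q^iH_k)(x;q)\,(D_q^lH_k)(y;q)}{\|H_k\|^2}$. Sobolev-type inner product: $\langle f,g\rangle_\lambda=\int_{-1}^1f(x)g(x)(qx,-qx;q)_\infty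 d_qx+\lambda (D_q^jf)(\alpha)(D_q^jg)(\alpha)$, where $\int_{-1}^1h(t)d_qt=(1-q)\sum_{m\ge0}q^m\big(h(q^m)+h(-q^m)\big)$. The $q$-Hermite I-Sobolev type polynomial $\mathbb{H}_n(x;q)$ is the monic polynomial of degree $n$ in the sequence orthogonal with respect to $\langle\cdot,\cdot\rangle_\lambda$. With $\mathcal{E}_{1,n},\mathcal{F}_{1,n}$ as below, wherever $\mathcal{F}_{1,n}\not\equiv0$ it has the hypergeometric representation $$\mathbb{H}_n(x;q)=-\frac{\mathcal{F}_{1,n}(x)(1-\psi_n(x)q^{-1})q^{\binom n2-n+2}}{[n]_q\psi_n(x)(1-q)}\sum_{k\ge0}\frac{(q^{-n},x^{-1},\psi_n(x);q)_k}{(\psi_n(x)q^{-1};q)_k\,(q;q)_k}(-qx)^k,$$ with $\psi_n=((1-q)\vartheta_n+1)^{-1}$, $\vartheta_n=-\frac{q^{n-2}[n]_q\mathcal{E}_{1,n}}{\mathcal{F}_{1,n}}-[n-1]_q$. Put $\mathcal{A}_n^{(j)}(x,y)=\frac{[j]_q!}{\|H_{n-1}\|^2(x\boxminus_qy)^{j+1}}\sum_{k=0}^j\frac{(D_q^kH_{n-1})(y;q)}{[k]_q!}(x\boxminus_qy)^k$, $\mathcal{B}_n^{(j)}(x,y)=-\frac{[j]_q!}{\|H_{n-1}\|^2(x\boxminus_qy)^{j+1}}\sum_{k=0}^j\frac{(D_q^kH_{n})(y;q)}{[k]_q!}(x\boxminus_qy)^k$. With $D_q$ acting on $x$: $\mathcal{C}_{1,n}(x,y)=D_q\mathcal{A}_n^{(j)}(x,y)-[n-1]_q\gamma_{n-1}^{-1}\mathcal{B}_n^{(j)}(qx,y)$,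 $\mathcal{D}_{1,n}(x,y)=[n]_q\mathcal{A}_n^{(j)}(qx,y)+[n-1]_q\gamma_{n-1}^{-1}x\,\mathcal{B}_n^{(j)}(qx,y)+D_q\mathcal{B}_n^{(j)}(x,y)$, $\mathcal{C}_{2,n}(x,y)=D_q\mathcal{C}_{1,n}(x,y)-[n-1]_q\gamma_{n-1}^{-1}\mathcal{D}_{1,n}(qx,y)$, $\mathcal{D}_{2,n}(x,y)=[n]_q\mathcal{C}_{1,n}(qx,y)+[n-1]_q\gamma_{n-1}^{-1}x\,\mathcal{D}_{1,n}(qx,y)+D_q\mathcal{D}_{1,n}(x,y)$. With $c_n=\lambda\frac{[n]_q^{(j)}H_{n-j}(\alpha;q)}{1+\lambda K_{n-1,q}^{(j,j)}(\alpha,\alpha)}$: $\mathcal{E}_{1,n}(x)=1-c_n\mathcal{A}_n^{(j)}(x,\alpha)$, $\mathcal{F}_{1,n}(x)=-c_n\mathcal{B}_n^{(j)}(x,\alpha)$; $\mathcal{E}_{2,n}(x)=-\mathcal{F}_{1,n-1}(x)/\gamma_{n-1}$, $\mathcal{F}_{2,n}(x)=\mathcal{E}_{1,n-1}(x)-x\mathcal{E}_{2,n}(x)$; $\mathcal{E}_{3,n}(x)=-c_n\mathcal{C}_{1,n}(x,\alpha)$, $\mathcal{F}_{3,n}(x)=[n]_q-c_n\mathcal{D}_{1,n}(x,\alpha)$; $\mathcal{E}_{5,n}(x)=-[n]_q^{(2)}\gamma_{n-1}^{-1}-c_n\mathcal{C}_{2,n}(x,\alpha)$, $\mathcal{F}_{5,n}(x)=[n]_q^{(2)}\gamma_{n-1}^{-1}x-c_n\mathcal{D}_{2,n}(x,\alpha)$;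 $\Xi_{1,n}=\mathcal{E}_{1,n}\mathcal{F}_{2,n}-\mathcal{E}_{2,n}\mathcal{F}_{1,n}$; $\mathcal{E}_{4,n}=-(\mathcal{E}_{2,n}\mathcal{F}_{3,n}-\mathcal{E}_{3,n}\mathcal{F}_{2,n})$, $\mathcal{F}_{4,n}=\mathcal{E}_{1,n}\mathcal{F}_{3,n}-\mathcal{E}_{3,n}\mathcal{F}_{1,n}$; $\mathcal{E}_{6,n}=-(\mathcal{E}_{2,n}\mathcal{F}_{5,n}-\mathcal{E}_{5,n}\mathcal{F}_{2,n})$, $\mathcal{F}_{6,n}=\mathcal{E}_{1,n}\mathcal{F}_{5,n}-\mathcal{E}_{5,n}\mathcal{F}_{1,n}$. *)

theory Defs
  imports "HOL-Analysis.Analysis" "HOL-Computational_Algebra.Polynomial"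
begin

section \<open>q-calculus\<close>

context
  fixes q :: real
begin

definition qnum :: "int \<Rightarrow> real" where
  "qnum n = (1 - q powi n) / (1 - q)"

definition qfact :: "nat \<Rightarrow> real" where
  "qfact n = (\<Prod>i=1..n. qnum (int i))"

definition qpoch :: "real \<Rightarrow> nat \<Rightarrow> real" where
  "qpoch a n = (\<Prod>i<n. 1 - a * q ^ i)"

definition qpoch_inf :: "real \<Rightarrow> real" where
  "qpoch_inf a = (\<Prod>i. 1 - a * q ^ i)"

definition qfall :: "int \<Rightarrow> nat \<Rightarrow> real" where
  "qfall n k = qpoch (q powi (- n)) k / (q - 1) ^ k * q powi (int k * n - int (k choose 2))"

definition qderiv :: "(real \<Rightarrow> real) \<Rightarrow> real \<Rightarrow> real" where
  "qderiv f x = (if x = 0 then deriv f 0 else (f (q * x) - f x) / ((q - 1) * x))"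

definition qsub_pow :: "real \<Rightarrow> real \<Rightarrow> nat \<Rightarrow> real" where
  "qsub_pow x y m =
     (\<Sum>k\<le>m. qfact m / (qfact k * qfact (m - k)) * q ^ (k choose 2) * (- y) ^ k * x ^ (m - k))"

definition jackson_integral :: "(real \<Rightarrow> real) \<Rightarrow> real" where
  "jackson_integral h = (1 - q) * (\<Sum>m. q ^ m * (h (q ^ m) + h (- (q ^ m))))"

section \<open>Monic q-Hermite I polynomials\<close>

text \<open>The factor \<open>(x\<^sup>-\<^sup>1; q)\<^sub>k x\<^sup>k\<close> of the hypergeometric form is written as the product of the
  \<open>x - q\<^sup>i\<close> over \<open>i < k\<close>, so that the value at \<open>x = 0\<close> is that of the polynomial;
  \<open>qHermite_hypergeometric\<close> below recovers the hypergeometric form for nonzero \<open>x\<close>.\<close>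

definition qHermite :: "int \<Rightarrow> real \<Rightarrow> real" where
  "qHermite n x =
     (if n < 0 then 0
      else q ^ (nat n choose 2) *
        (\<Sum>k\<le>nat n. qpoch (q powi (- n)) k * (\<Prod>i<k. x - q ^ i) / qpoch q k * (- q) ^ k))"

lemma qHermite_hypergeometric:
  assumes "x \<noteq> 0" "n \<ge> 0"
  shows "qHermite n x = q ^ (nat n choose 2) *
    (\<Sum>k\<le>nat n. qpoch (q powi (- n)) k * qpoch (inverse x) k / qpoch q k * (- q * x) ^ k)"
proof -
  have "(\<Prod>i<k. x - q ^ i) = qpoch (inverse x) k * x ^ k" for k
  proof (induction k)
    case 0
    then show ?case by (simp add: qpoch_def)
  next
    case (Suc k)
    have "(\<Prod>i<Suc k. x - q ^ i) = qpoch (inverse x) k * x ^ k * (x - q ^ k)"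
      using Suc by simp
    also have "x - q ^ k = (1 - inverse x * q ^ k) * x"
      using assms(1) by (simp add: field_simps)
    finally show ?case by (simp add: qpoch_def)
  qed
  then show ?thesis
    using assms(2) by (simp add: qHermite_def power_mult_distrib power_minus[of "q * x"] power_minus[of q] mult_ac)
qed

definition gam :: "int \<Rightarrow> real" where
  "gam n = q powi (n - 1) * (1 - q powi n)"

text \<open>The squared norm of \<open>H\<^sub>n\<close>. The convention \<open>1 / (q; q)\<^sub>n = 0\<close> for \<open>n < 0\<close> is encoded by
  giving the norm the value \<open>0\<close> there, since \<open>1 / 0 = 0\<close> in HOL. It is needed only for the kernel
  coefficients below at index \<open>0\<close>.\<close>

definition sqnorm :: "int \<Rightarrow> real" where
  "sqnorm n =
     (if n < 0 then 0
      else (1 - q) * qpoch q (nat n) * (qpoch_inf q * qpoch_inf (- 1) * qpoch_inf (- q))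
             * q ^ (nat n choose 2))"

definition kernel :: "int \<Rightarrow> nat \<Rightarrow> nat \<Rightarrow> real \<Rightarrow> real \<Rightarrow> real" where
  "kernel n i l x y =
     (\<Sum>k=0..n. (qderiv ^^ i) (qHermite k) x * (qderiv ^^ l) (qHermite k) y / sqnorm k)"

section \<open>Sobolev-type orthogonality\<close>

definition sobolev_inner ::
    "real \<Rightarrow> real \<Rightarrow> nat \<Rightarrow> (real \<Rightarrow> real) \<Rightarrow> (real \<Rightarrow> real) \<Rightarrow> real" where
  "sobolev_inner \<alpha> lam j f g =
     jackson_integral (\<lambda>x. f x * g x * (qpoch_inf (q * x) * qpoch_inf (- (q * x))))
       + lam * (qderiv ^^ j) f \<alpha> * (qderiv ^^ j) g \<alpha>"

definition sobolev_polys :: "real \<Rightarrow> real \<Rightarrow> nat \<Rightarrow> (nat \<Rightarrow> real poly) \<Rightarrow> bool" where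
  "sobolev_polys \<alpha> lam j P \<longleftrightarrow>
     (\<forall>n. degree (P n) = n \<and> lead_coeff (P n) = 1) \<and>
     (\<forall>m n. m \<noteq> n \<longrightarrow> sobolev_inner \<alpha> lam j (poly (P m)) (poly (P n)) = 0)"

section \<open>Coefficient functions\<close>

text \<open>Note that \<open>gam 0 = 0\<close>. Hence \<open>1 / gam (n - 1)\<close> is undefined on paper for \<open>n = 1\<close>; there it
  only ever occurs with a vanishing factor (\<open>qnum 0\<close>, \<open>qfall 1 2\<close> or \<open>F1 0 x\<close>), and \<open>1 / 0 = 0\<close>
  makes these products \<open>0\<close>.\<close>

definition Acoef :: "nat \<Rightarrow> int \<Rightarrow> real \<Rightarrow> real \<Rightarrow> real" where
  "Acoef j n x y = qfact j / (sqnorm (n - 1) * qsub_pow x y (j + 1)) *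
     (\<Sum>k\<le>j. (qderiv ^^ k) (qHermite (n - 1)) y / qfact k * qsub_pow x y k)"

definition Bcoef :: "nat \<Rightarrow> int \<Rightarrow> real \<Rightarrow> real \<Rightarrow> real" where
  "Bcoef j n x y = - (qfact j / (sqnorm (n - 1) * qsub_pow x y (j + 1))) *
     (\<Sum>k\<le>j. (qderiv ^^ k) (qHermite n) y / qfact k * qsub_pow x y k)"

definition C1 :: "nat \<Rightarrow> int \<Rightarrow> real \<Rightarrow> real \<Rightarrow> real" where
  "C1 j n x y = qderiv (\<lambda>t. Acoef j n t y) x - qnum (n - 1) / gam (n - 1) * Bcoef j n (q * x) y"

definition D1 :: "nat \<Rightarrow> int \<Rightarrow> real \<Rightarrow> real \<Rightarrow> real" where
  "D1 j n x y = qnum n * Acoef j n (q * x) y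
     + qnum (n - 1) / gam (n - 1) * x * Bcoef j n (q * x) y + qderiv (\<lambda>t. Bcoef j n t y) x"

definition C2 :: "nat \<Rightarrow> int \<Rightarrow> real \<Rightarrow> real \<Rightarrow> real" where
  "C2 j n x y = qderiv (\<lambda>t. C1 j n t y) x - qnum (n - 1) / gam (n - 1) * D1 j n (q * x) y"

definition D2 :: "nat \<Rightarrow> int \<Rightarrow> real \<Rightarrow> real \<Rightarrow> real" where
  "D2 j n x y = qnum n * C1 j n (q * x) y
     + qnum (n - 1) / gam (n - 1) * x * D1 j n (q * x) y + qderiv (\<lambda>t. D1 j n t y) x"

end

context
  fixes q \<alpha> lam :: real and j :: nat
begin

definition ccoef :: "int \<Rightarrow> real" where
  "ccoef n = lam * (qfall q n j * qHermite q (n - int j) \<alpha> / (1 + lam * kernel q (n - 1) j j \<alpha> \<alpha>))"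

definition E1 :: "int \<Rightarrow> real \<Rightarrow> real" where
  "E1 n x = 1 - ccoef n * Acoef q j n x \<alpha>"

definition F1 :: "int \<Rightarrow> real \<Rightarrow> real" where
  "F1 n x = - ccoef n * Bcoef q j n x \<alpha>"

definition E2 :: "int \<Rightarrow> real \<Rightarrow> real" where
  "E2 n x = - F1 (n - 1) x / gam q (n - 1)"

definition F2 :: "int \<Rightarrow> real \<Rightarrow> real" where
  "F2 n x = E1 (n - 1) x - x * E2 n x"

definition E3 :: "int \<Rightarrow> real \<Rightarrow> real" where
  "E3 n x = - ccoef n * C1 q j n x \<alpha>"

definition F3 :: "int \<Rightarrow> real \<Rightarrow> real" where
  "F3 n x = qnum q n - ccoef n * D1 q j n x \<alpha>"

definition E5 :: "int \<Rightarrow> real \<Rightarrow> real" where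
  "E5 n x = - (qfall q n 2 / gam q (n - 1)) - ccoef n * C2 q j n x \<alpha>"

definition F5 :: "int \<Rightarrow> real \<Rightarrow> real" where
  "F5 n x = qfall q n 2 / gam q (n - 1) * x - ccoef n * D2 q j n x \<alpha>"

definition Xi1 :: "int \<Rightarrow> real \<Rightarrow> real" where
  "Xi1 n x = E1 n x * F2 n x - E2 n x * F1 n x"

definition E4 :: "int \<Rightarrow> real \<Rightarrow> real" where
  "E4 n x = - (E2 n x * F3 n x - E3 n x * F2 n x)"

definition F4 :: "int \<Rightarrow> real \<Rightarrow> real" where
  "F4 n x = E1 n x * F3 n x - E3 n x * F1 n x"

definition E6 :: "int \<Rightarrow> real \<Rightarrow> real" where
  "E6 n x = - (E2 n x * F5 n x - E5 n x * F2 n x)"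

definition F6 :: "int \<Rightarrow> real \<Rightarrow> real" where
  "F6 n x = E1 n x * F5 n x - E5 n x * F1 n x"

definition Rcoef :: "int \<Rightarrow> real \<Rightarrow> real" where
  "Rcoef n x = F4 n x * Xi1 n x"

definition Scoef :: "int \<Rightarrow> real \<Rightarrow> real" where
  "Scoef n x = - F6 n x * Xi1 n x"

definition Tcoef :: "int \<Rightarrow> real \<Rightarrow> real" where
  "Tcoef n x = E4 n x * F6 n x - E6 n x * F4 n x"

end

text \<open>The \<open>q\<close>-difference equation is an identity between rational functions of \<open>x\<close>. Its
  coefficients evaluate \<open>Acoef\<close> and \<open>Bcoef\<close> at \<open>x\<close>, \<open>q x\<close> and \<open>q\<^sup>2 x\<close>; this predicate says that
  their denominators do not vanish at these three points.\<close>

definition coefs_defined :: "real \<Rightarrow> real \<Rightarrow> nat \<Rightarrow> real \<Rightarrow> bool" where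
  "coefs_defined q \<alpha> j x \<longleftrightarrow> (\<forall>m\<le>2. qsub_pow q (q ^ m * x) \<alpha> (j + 1) \<noteq> 0)"

end

theory Submission
  imports Defs
begin

text \<open>
  The equation is elimination in a space of dimension two. Over the rational functions, \<open>P\<^sub>n\<close>,
  \<open>D\<^sub>q P\<^sub>n\<close> and \<open>D\<^sub>q\<^sup>2 P\<^sub>n\<close> are all combinations of \<open>H\<^sub>n\<close> and \<open>H\<^sub>n\<^sub>-\<^sub>1\<close>, with coefficient pairs
  \<open>(E\<^sub>1, F\<^sub>1)\<close>, \<open>(E\<^sub>3, F\<^sub>3)\<close> and \<open>(E\<^sub>5, F\<^sub>5)\<close>; hence they are linearly dependent. With
  \<open>G = E\<^sub>2 H\<^sub>n + F\<^sub>2 H\<^sub>n\<^sub>-\<^sub>1\<close> as a second reference function, Cramer's rule expresses \<open>\<Xi>\<^sub>1 D\<^sub>q P\<^sub>n\<close> and \<open>\<Xi>\<^sub>1 D\<^sub>q\<^sup>2 P\<^sub>n\<close> through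
  \<open>P\<^sub>n\<close> and \<open>G\<close>, with coefficients \<open>(E\<^sub>4, F\<^sub>4)\<close> and \<open>(E\<^sub>6, F\<^sub>6)\<close>, and eliminating
  \<open>G\<close> gives the equation. This last step is a polynomial identity, so the work lies in the
  three expansions, at index \<open>n \<ge> 1\<close>; at \<open>n = 0\<close> all three coefficients vanish.

  The expansion of \<open>P\<^sub>n\<close> has two sources. Orthogonality of \<open>P\<^sub>n\<close> to all polynomials of lower degree
  for the Sobolev product determines the coordinates of \<open>P\<^sub>n - H\<^sub>n\<close> in the basis of the \<open>H\<^sub>k\<close> and gives
  \<open>P\<^sub>n(x) = H\<^sub>n(x) - c\<^sub>n K\<^sub>n\<^sub>-\<^sub>1(x, \<alpha>)\<close>, where the kernel is \<open>q\<close>-differentiated \<open>j\<close> times in its second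
  argument (\<open>sobolev_connection\<close>). This uses the orthogonality of the \<open>H\<^sub>k\<close> together with the exact
  values of their norms (\<open>hermite_orthogonal\<close>). Secondly, the Christoffel-Darboux formula states that
  \<open>x - y\<close> times the kernel is a combination of \<open>H\<^sub>n\<close> and \<open>H\<^sub>n\<^sub>-\<^sub>1\<close>. Differentiating that product \<open>j\<close>
  times in \<open>y\<close> and solving for the last derivative produces the functions \<open>A\<close> and \<open>B\<close>
  (\<open>qTaylor_of_linear_mult\<close>, \<open>kernel_eq_coefs\<close>).

  The other two expansions follow by \<open>q\<close>-differentiating a combination of \<open>H\<^sub>n\<close> and \<open>H\<^sub>n\<^sub>-\<^sub>1\<close> once more
  (\<open>qderiv_hermite_combination\<close>), where \<open>D\<^sub>q H\<^sub>n = [n] H\<^sub>n\<^sub>-\<^sub>1\<close> and the three-term recurrence removes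
  \<open>H\<^sub>n\<^sub>-\<^sub>2\<close>. For \<open>x \<noteq> 0\<close> this is algebra with difference quotients. At \<open>x = 0\<close>, where \<open>D\<^sub>q\<close> is an
  ordinary derivative, the identities are obtained from those at nearby points: all functions
  involved agree near the origin with rational functions, and this class is closed under \<open>D\<^sub>q\<close>
  (\<open>rational_at_0_qderiv\<close>).
\<close>

section \<open>The q-derivative of polynomials\<close>

locale q_in_unit_interval =
  fixes q :: real
  assumes q_pos: "0 < q" and q_less_1: "q < 1"
begin

lemma qnum_nat: "qnum q (int n) = (1 - q ^ n) / (1 - q)"
  by (simp add: qnum_def)

lemma qnum_Suc: "qnum q (int (Suc n)) = qnum q (int n) + q ^ n"
  using q_less_1 by (simp add: qnum_nat field_simps del: of_nat_Suc)

lemma qnum_Suc': "qnum q (int (Suc n)) = 1 + q * qnum q (int n)"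
  using q_less_1 by (simp add: qnum_nat field_simps del: of_nat_Suc)

lemma power_less_1: "n > 0 \<Longrightarrow> q ^ n < 1"
  using q_pos q_less_1 by (simp add: power_Suc_less_one power_less_one_iff)

lemma qnum_pos: "n > 0 \<Longrightarrow> qnum q (int n) > 0"
  using power_less_1[of n] q_less_1 by (simp add: qnum_nat)

lemma qfact_Suc: "qfact q (Suc n) = qfact q n * qnum q (int (Suc n))"
  by (simp add: qfact_def)

lemma qfact_pos: "qfact q n > 0"
  by (induction n) (simp_all add: qfact_Suc qnum_pos del: of_nat_Suc, simp add: qfact_def)

text \<open>The \<open>q\<close>-derivative as an operation on polynomials: the difference \<open>p(q x) - p(x)\<close> vanishes at the
  origin, so the division is exact. Working with polynomials makes the special clause of
  \<^const>\<open>qderiv\<close> at \<open>0\<close> disappear.\<close>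
definition poly_qderiv :: "real poly \<Rightarrow> real poly" where
  "poly_qderiv p = (p \<circ>\<^sub>p [:0, q:] - p) div [:0, q - 1:]"

lemma poly_qderiv_spec: "[:0, q - 1:] * poly_qderiv p = p \<circ>\<^sub>p [:0, q:] - p"
proof -
  have "poly (p \<circ>\<^sub>p [:0, q:] - p) 0 = 0"
    by (simp add: poly_pcompose)
  then have "[:0, 1:] dvd p \<circ>\<^sub>p [:0, q:] - p"
    by (simp only: poly_eq_0_iff_dvd) simp
  then have "smult (q - 1) [:0, 1:] dvd p \<circ>\<^sub>p [:0, q:] - p"
    using q_less_1 by (simp only: smult_dvd_iff) simp
  then show ?thesis
    unfolding poly_qderiv_def by (rule dvd_mult_div_cancel[OF subst[of _ _ "\<lambda>d. d dvd _"], rotated]) simp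
qed

lemma poly_qderiv_eqI:
  assumes "[:0, q - 1:] * r = p \<circ>\<^sub>p [:0, q:] - p"
  shows "poly_qderiv p = r"
proof -
  have "[:0, q - 1:] * (poly_qderiv p - r) = 0"
    using assms by (simp only: right_diff_distrib poly_qderiv_spec diff_self)
  moreover have "[:0, q - 1:] \<noteq> 0" using q_less_1 by simp
  ultimately show ?thesis by (simp only: mult_eq_0_iff) simp
qed

lemma poly_qderiv_add: "poly_qderiv (p + r) = poly_qderiv p + poly_qderiv r"
  by (rule poly_qderiv_eqI)
     (simp only: distrib_left poly_qderiv_spec pcompose_add add_diff_add)

lemma poly_qderiv_smult: "poly_qderiv (smult c p) = smult c (poly_qderiv p)"
  by (rule poly_qderiv_eqI)
     (simp only: mult_smult_right poly_qderiv_spec pcompose_smult smult_diff_right)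

lemma poly_qderiv_const: "poly_qderiv [:c:] = 0"
  by (rule poly_qderiv_eqI) simp

lemma poly_qderiv_0 [simp]: "poly_qderiv 0 = 0"
  by (rule poly_qderiv_eqI) simp

lemma poly_qderiv_diff: "poly_qderiv (p - r) = poly_qderiv p - poly_qderiv r"
  using poly_qderiv_add[of p "smult (-1) r"] by (simp only: poly_qderiv_smult) simp

lemma smult_sum_right: "smult c (\<Sum>i\<in>A. f i) = (\<Sum>i\<in>A. smult c (f i))"
  by (induction A rule: infinite_finite_induct) (simp_all add: smult_add_right)

lemma poly_qderiv_sum: "poly_qderiv (\<Sum>i\<in>A. f i) = (\<Sum>i\<in>A. poly_qderiv (f i))"
  by (induction A rule: infinite_finite_induct) (simp_all add: poly_qderiv_add)

lemma poly_qderiv_mult: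
  "poly_qderiv (f * g) = (f \<circ>\<^sub>p [:0, q:]) * poly_qderiv g + g * poly_qderiv f"
proof (rule poly_qderiv_eqI)
  have "[:0, q - 1:] * ((f \<circ>\<^sub>p [:0, q:]) * poly_qderiv g + g * poly_qderiv f)
      = (f \<circ>\<^sub>p [:0, q:]) * ([:0, q - 1:] * poly_qderiv g) + g * ([:0, q - 1:] * poly_qderiv f)"
    by (simp only: distrib_left mult.left_commute)
  also have "\<dots> = (f * g) \<circ>\<^sub>p [:0, q:] - f * g"
    unfolding poly_qderiv_spec by (simp add: pcompose_mult algebra_simps)
  finally show "[:0, q - 1:] * ((f \<circ>\<^sub>p [:0, q:]) * poly_qderiv g + g * poly_qderiv f)
      = (f * g) \<circ>\<^sub>p [:0, q:] - f * g" .
qed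

lemma poly_qderiv_linear: "poly_qderiv [:a, b:] = [:b:]"
  by (rule poly_qderiv_eqI) (simp add: pcompose_pCons algebra_simps)

lemma poly_qderiv_spec_at: "(q - 1) * x * poly (poly_qderiv p) x = poly p (q * x) - poly p x"
proof -
  have "poly ([:0, q - 1:] * poly_qderiv p) x = poly (p \<circ>\<^sub>p [:0, q:] - p) x"
    by (simp only: poly_qderiv_spec)
  then show ?thesis by (simp add: poly_pcompose mult_ac)
qed

lemma deriv_poly: "deriv (poly p) x = poly (pderiv p) x" for p :: "real poly"
  by (rule DERIV_imp_deriv) (rule poly_DERIV)

text \<open>Differentiating \<open>(q - 1) x (D\<^sub>q p)(x) = p(q x) - p(x)\<close> at the origin gives
  \<open>(q - 1) (D\<^sub>q p)(0) = (q - 1) p'(0)\<close>; this is why the clause \<^term>\<open>deriv f 0\<close> is the continuous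
  choice.\<close>
lemma poly_qderiv_at_0: "poly (poly_qderiv p) 0 = poly (pderiv p) 0"
proof -
  have "poly (pderiv ([:0, q - 1:] * poly_qderiv p)) 0 = poly (pderiv (p \<circ>\<^sub>p [:0, q:] - p)) 0"
    by (simp only: poly_qderiv_spec)
  then have "(q - 1) * poly (poly_qderiv p) 0 = (q - 1) * poly (pderiv p) 0"
    by (simp add: pderiv_mult pderiv_pcompose pderiv_diff pderiv_pCons poly_pcompose algebra_simps)
  then show ?thesis using q_less_1 by simp
qed

lemma qderiv_poly: "qderiv q (poly p) = poly (poly_qderiv p)"
proof
  fix x
  show "qderiv q (poly p) x = poly (poly_qderiv p) x"
    using poly_qderiv_spec_at[of x p] q_less_1
    by (auto simp: qderiv_def deriv_poly poly_qderiv_at_0 divide_simps mult_ac)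
qed

lemma qderiv_funpow_poly: "(qderiv q ^^ k) (poly p) = poly ((poly_qderiv ^^ k) p)"
  by (induction k) (simp_all add: qderiv_poly)

lemma poly_qderiv_funpow_diff:
  "(poly_qderiv ^^ k) (p - r) = (poly_qderiv ^^ k) p - (poly_qderiv ^^ k) r"
  by (induction k) (simp_all add: poly_qderiv_diff)

lemma poly_qderiv_funpow_smult:
  "(poly_qderiv ^^ k) (smult c p) = smult c ((poly_qderiv ^^ k) p)"
  by (induction k) (simp_all add: poly_qderiv_smult)

lemma poly_qderiv_funpow_sum:
  "(poly_qderiv ^^ k) (\<Sum>i\<in>A. f i) = (\<Sum>i\<in>A. (poly_qderiv ^^ k) (f i))"
  by (induction k) (simp_all add: poly_qderiv_sum)

lemma power_tendsto_0: "(\<lambda>m. q ^ m) \<longlonglongrightarrow> 0"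
  using q_pos q_less_1 by (intro LIMSEQ_realpow_zero) auto

text \<open>A polynomial with zero \<open>q\<close>-derivative takes the same value at \<open>x\<close> and at all \<open>q\<^sup>m x\<close>, and these
  points tend to \<open>0\<close>.\<close>
lemma poly_qderiv_eq_0_imp_const:
  assumes "poly_qderiv p = 0"
  shows "poly p x = poly p 0"
proof -
  have step: "poly p (q * y) = poly p y" for y
    using poly_qderiv_spec_at[of y p] assms by simp
  have "poly p (q ^ m * x) = poly p x" for m
  proof (induction m)
    case (Suc m)
    then show ?case using step[of "q ^ m * x"] by (simp add: mult.assoc)
  qed simp
  moreover have "(\<lambda>m. poly p (q ^ m * x)) \<longlonglongrightarrow> poly p (0 * x)"
    by (intro tendsto_poly tendsto_mult power_tendsto_0 tendsto_const)
  ultimately show ?thesis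
    by (simp add: LIMSEQ_const_iff)
qed

lemma poly_eqI_qderiv:
  assumes "poly_qderiv p = poly_qderiv r" and "poly p a = poly r a"
  shows "p = r"
proof -
  have "poly_qderiv (p - r) = 0" using assms(1) by (simp add: poly_qderiv_diff)
  then have "poly (p - r) x = poly (p - r) a" for x
    using poly_qderiv_eq_0_imp_const[of "p - r"] by metis
  then have "poly (p - r) x = 0" for x using assms(2) by simp
  then have "p - r = 0" using poly_all_0_iff_0 by blast
  then show ?thesis by simp
qed

section \<open>The monic q-Hermite I polynomials\<close>

text \<open>The polynomials are generated from their three-term recurrence and identified with the
  hypergeometric sum afterwards (\<open>qHermite_eq_poly\<close>).\<close>
fun hermite_poly :: "nat \<Rightarrow> real poly" where
  "hermite_poly 0 = 1"
| "hermite_poly (Suc 0) = [:0, 1:]"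
| "hermite_poly (Suc (Suc n)) =
     [:0, 1:] * hermite_poly (Suc n) - smult (gam q (int (Suc n))) (hermite_poly n)"

lemma gam_0 [simp]: "gam q 0 = 0" by (simp add: gam_def)

lemma gam_Suc: "gam q (int (Suc n)) = q ^ n * (1 - q ^ Suc n)"
  by (simp add: gam_def power_int_add flip: power_int_of_nat)

lemma gam_Suc_pos: "gam q (int (Suc n)) > 0"
  using power_less_1[of "Suc n"] q_pos by (simp only: gam_Suc) simp

lemma hermite_recurrence:
  "[:0, 1:] * hermite_poly n = hermite_poly (Suc n) + smult (gam q (int n)) (hermite_poly (n - 1))"
  by (cases n) (simp_all)

lemma degree_lead_coeff_hermite:
  "degree (hermite_poly n) = n \<and> lead_coeff (hermite_poly n) = 1"
proof (induction n rule: hermite_poly.induct)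
  case (3 n)
  let ?s = "smult (gam q (int (Suc n))) (hermite_poly n)"
  have nz: "hermite_poly (Suc n) \<noteq> 0" using 3 by auto
  then have d: "degree ([:0, 1:] * hermite_poly (Suc n)) = Suc (Suc n)"
    using 3 by (simp add: degree_mult_eq)
  have ds: "degree (- ?s) < Suc (Suc n)" using 3 by (simp add: le_less_trans[OF degree_smult_le])
  have eq: "hermite_poly (Suc (Suc n)) = - ?s + [:0, 1:] * hermite_poly (Suc n)" by simp
  have "degree (hermite_poly (Suc (Suc n))) = Suc (Suc n)"
    unfolding eq using d ds by (subst degree_add_eq_right) auto
  moreover have "lead_coeff (hermite_poly (Suc (Suc n))) = 1"
    unfolding eq using d ds 3 by (subst lead_coeff_add_le) (auto simp: lead_coeff_mult)
  ultimately show ?case by blast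
qed auto

lemma poly_qderiv_1 [simp]: "poly_qderiv 1 = 0"
  using poly_qderiv_const[of 1] by (simp add: one_pCons)

lemma poly_qderiv_X_mult: "poly_qderiv ([:0, 1:] * p) = p + smult q ([:0, 1:] * poly_qderiv p)"
  unfolding poly_qderiv_mult by (simp add: poly_qderiv_linear pcompose_pCons one_pCons)

lemma poly_qderiv_hermite:
  "poly_qderiv (hermite_poly n) = smult (qnum q (int n)) (hermite_poly (n - 1))"
proof (induction n rule: hermite_poly.induct)
  case 1
  show ?case by (simp add: qnum_def)
next
  case 2
  show ?case using q_less_1 by (simp add: poly_qderiv_linear qnum_def one_pCons)
next
  case (3 n)
  let ?Q = "\<lambda>n. qnum q (int n)" and ?g = "\<lambda>n. gam q (int n)"
  have c: "q * ?Q (Suc n) * ?g n = ?g (Suc n) * ?Q n"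
    using q_less_1 by (cases n) (simp_all only: gam_Suc qnum_nat, simp_all add: field_simps)
  have "poly_qderiv (hermite_poly (Suc (Suc n)))
      = hermite_poly (Suc n) + smult (q * ?Q (Suc n)) ([:0, 1:] * hermite_poly n)
        - smult (?g (Suc n) * ?Q n) (hermite_poly (n - 1))"
    using 3 by (simp only: hermite_poly.simps poly_qderiv_diff poly_qderiv_smult poly_qderiv_X_mult)
      simp
  also have "\<dots> = smult (1 + q * ?Q (Suc n)) (hermite_poly (Suc n))"
    unfolding hermite_recurrence smult_add_right smult_smult c[symmetric]
    by (simp add: smult_add_left)
  finally show ?case by (simp only: qnum_Suc') simp
qed

lemma choose_two_Suc: "Suc n choose 2 = (n choose 2) + n"
  by (simp add: numeral_2_eq_2)

text \<open>The point \<open>1\<close> is the one where the hypergeometric sum reduces to its first term; the value there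
  fixes the constant of integration in \<open>explicit_hermite\<close>.\<close>
lemma poly_hermite_1: "poly (hermite_poly n) 1 = q ^ (n choose 2)"
proof (induction n rule: hermite_poly.induct)
  case (3 n)
  then show ?case
    by (simp only: hermite_poly.simps poly_diff poly_mult poly_smult gam_Suc choose_two_Suc)
       (simp add: power_add algebra_simps)
qed (auto simp: numeral_2_eq_2)

text \<open>The polynomial \<open>(x\<^sup>-\<^sup>1; q)\<^sub>k x\<^sup>k\<close>, whose roots are \<open>1, q, \<dots>, q\<^bsup>k-1\<^esup>\<close>. The operator \<open>D\<^sub>q\<close> acts on these
  polynomials as the derivative does on powers.\<close>
definition qbasis :: "nat \<Rightarrow> real poly" where
  "qbasis k = (\<Prod>i<k. [:- (q ^ i), 1:])"

lemma qbasis_Suc: "qbasis (Suc k) = qbasis k * [:- (q ^ k), 1:]"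
  by (simp add: qbasis_def mult.commute)

lemma poly_qderiv_qbasis:
  "poly_qderiv (qbasis (Suc k)) = smult (qnum q (int (Suc k))) (qbasis k)"
proof (induction k)
  case 0
  show ?case using q_less_1 by (simp add: qbasis_def poly_qderiv_linear qnum_def one_pCons)
next
  case (Suc k)
  have "poly_qderiv (qbasis (Suc (Suc k)))
     = poly_qderiv ([:- (q ^ Suc k), 1:] * qbasis (Suc k))"
    by (simp only: qbasis_Suc mult.commute)
  also have "\<dots> = ([:- (q ^ Suc k), q:] * smult (qnum q (int (Suc k))) (qbasis k)) + qbasis (Suc k)"
    unfolding poly_qderiv_mult Suc by (simp add: poly_qderiv_linear pcompose_pCons)
  also have "[:- (q ^ Suc k), q:] = smult q [:- (q ^ k), 1:]"
    by simp
  also have "smult q [:- (q ^ k), 1:] * smult (qnum q (int (Suc k))) (qbasis k) + qbasis (Suc k)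
     = smult (1 + q * qnum q (int (Suc k))) (qbasis (Suc k))"
  proof -
    have "smult q L * smult r B + B * L = smult (1 + q * r) (B * L)" for L B r
      by (simp add: smult_add_left mult.commute)
    then show ?thesis unfolding qbasis_Suc .
  qed
  finally show ?case by (simp only: qnum_Suc')
qed

lemma qpoch_Suc: "qpoch q a (Suc n) = qpoch q a n * (1 - a * q ^ n)"
  by (simp add: qpoch_def)

lemma qpoch_Suc_shift: "qpoch q a (Suc n) = (1 - a) * qpoch q (a * q) n"
  unfolding qpoch_def by (subst prod.lessThan_Suc_shift) (simp add: mult_ac)

lemma qpoch_q_pos: "qpoch q q n > 0"
  using power_less_1[of "Suc _"] unfolding qpoch_def by (intro prod_pos) simp

definition hermite_coeff :: "nat \<Rightarrow> nat \<Rightarrow> real" where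
  "hermite_coeff n k = q ^ (n choose 2) * (qpoch q (q powi (- int n)) k / qpoch q q k * (- q) ^ k)"

lemma hermite_coeff_Suc:
  "hermite_coeff (Suc n) (Suc k) * qnum q (int (Suc k)) = qnum q (int (Suc n)) * hermite_coeff n k"
proof -
  have a: "q powi (- int (Suc n)) * q = q powi (- int n)"
    using q_pos by (simp only: power_int_minus power_int_of_nat) (simp add: field_simps)
  have p: "qpoch q (q powi (- int (Suc n))) (Suc k)
      = (1 - q powi (- int (Suc n))) * qpoch q (q powi (- int n)) k"
    unfolding qpoch_Suc_shift a ..
  have i: "q powi (- int (Suc n)) = 1 / q ^ Suc n"
    using q_pos by (simp only: power_int_minus power_int_of_nat) (simp add: field_simps)
  have nz: "qpoch q q k \<noteq> 0" "1 - q ^ Suc k \<noteq> 0" "q \<noteq> 0"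
    using qpoch_q_pos[of k] power_less_1[of "Suc k"] q_pos by auto
  have e: "qpoch q q (Suc k) = qpoch q q k * (1 - q ^ Suc k)" by (simp add: qpoch_Suc)
  show ?thesis
    unfolding hermite_coeff_def p e choose_two_Suc qnum_nat power_add
    unfolding i
    using nz q_less_1 by (simp add: divide_simps) (simp add: algebra_simps)
qed

text \<open>Both sides have \<open>D\<^sub>q f\<^sub>n = [n] f\<^sub>n\<^sub>-\<^sub>1\<close> and the same value at \<open>1\<close>, so they agree by induction on \<open>n\<close>.\<close>
lemma explicit_hermite:
  "(\<Sum>k\<le>n. smult (hermite_coeff n k) (qbasis k)) = hermite_poly n" (is "?e n = _")
proof (induction n)
  case 0
  show ?case by (simp add: hermite_coeff_def qbasis_def qpoch_def numeral_2_eq_2)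
next
  case (Suc n)
  show ?case
  proof (rule poly_eqI_qderiv)
    have "poly_qderiv (?e (Suc n))
      = (\<Sum>k\<le>Suc n. smult (hermite_coeff (Suc n) k) (poly_qderiv (qbasis k)))"
      by (simp only: poly_qderiv_sum poly_qderiv_smult)
    also have "\<dots> = (\<Sum>k\<le>n. smult (hermite_coeff (Suc n) (Suc k) * qnum q (int (Suc k))) (qbasis k))"
      by (subst sum.atMost_Suc_shift) (simp add: poly_qderiv_qbasis, simp add: qbasis_def)
    also have "\<dots> = smult (qnum q (int (Suc n))) (?e n)"
      by (simp only: hermite_coeff_Suc smult_sum_right smult_smult)
    finally show "poly_qderiv (?e (Suc n)) = poly_qderiv (hermite_poly (Suc n))"
      by (simp only: Suc poly_qderiv_hermite) simp
    have z: "poly (qbasis k) 1 = (if k = 0 then 1 else 0)" for k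
      by (auto simp: qbasis_def poly_prod intro!: bexI[of _ 0])
    have "poly (?e (Suc n)) 1 = hermite_coeff (Suc n) 0"
      by (simp add: poly_sum z mult_delta_right)
    then show "poly (?e (Suc n)) 1 = poly (hermite_poly (Suc n)) 1"
      by (simp add: poly_hermite_1 hermite_coeff_def qpoch_def)
  qed
qed

lemma qHermite_eq_poly: "qHermite q (int n) = poly (hermite_poly n)"
proof
  fix x
  have b: "poly (qbasis k) x = (\<Prod>i<k. x - q ^ i)" for k
    by (simp add: qbasis_def poly_prod)
  show "qHermite q (int n) x = poly (hermite_poly n) x"
    unfolding qHermite_def explicit_hermite[symmetric]
    by (simp add: poly_sum hermite_coeff_def b sum_distrib_left mult_ac)
qed

section \<open>The weight on the q-lattice and orthogonality\<close>

lemma qpoch_convergent: "convergent_prod (\<lambda>i. 1 - a * q ^ i)"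
proof -
  have "summable (\<lambda>i. norm ((1 - a * q ^ i) - 1))"
    using q_pos q_less_1 by (simp add: abs_mult power_abs)
  then show ?thesis
    by (intro abs_convergent_prod_imp_convergent_prod) (simp only: abs_convergent_prod_conv_summable)
qed

lemma qpoch_tendsto: "(\<lambda>n. qpoch q a n) \<longlonglongrightarrow> qpoch_inf q a"
proof -
  have "(\<lambda>n. qpoch q a (Suc n)) \<longlonglongrightarrow> qpoch_inf q a"
    using convergent_prod_LIMSEQ[OF qpoch_convergent[of a]]
    by (simp add: qpoch_def qpoch_inf_def lessThan_Suc_atMost)
  then show ?thesis by (rule LIMSEQ_imp_Suc)
qed

lemma qpoch_inf_shift: "qpoch_inf q a = (1 - a) * qpoch_inf q (a * q)"
proof (rule LIMSEQ_unique)
  show "(\<lambda>n. qpoch q a (Suc n)) \<longlonglongrightarrow> qpoch_inf q a"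
    using qpoch_tendsto by (rule LIMSEQ_Suc)
  show "(\<lambda>n. qpoch q a (Suc n)) \<longlonglongrightarrow> (1 - a) * qpoch_inf q (a * q)"
    unfolding qpoch_Suc_shift by (intro tendsto_mult_left qpoch_tendsto)
qed

lemma qpoch_inf_pos:
  assumes "a < 1"
  shows "qpoch_inf q a > 0"
proof -
  have f: "1 - a * q ^ i > 0" for i
  proof -
    have "q ^ i \<le> 1" "q ^ i > 0" using q_pos q_less_1 by (auto simp: power_le_one)
    then have "a * q ^ i < 1"
      using assms by (smt (verit) mult_le_0_iff mult_less_cancel_right2 mult_right_le_one_le)
    then show ?thesis by simp
  qed
  then have "qpoch_inf q a \<noteq> 0"
    unfolding qpoch_inf_def by (intro prodinf_nonzero qpoch_convergent) (metis less_irrefl)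
  moreover have "qpoch_inf q a \<ge> 0"
    by (rule LIMSEQ_le_const[OF qpoch_tendsto])
       (auto simp: qpoch_def intro!: prod_nonneg less_imp_le[OF f])
  ultimately show ?thesis by simp
qed

text \<open>The value of \<open>(q x, - q x; q)\<^sub>\<infinity>\<close> at the lattice points \<open>x = \<plusminus> q\<^sup>m\<close>; the two signs give the same
  value.\<close>
definition weight :: "nat \<Rightarrow> real" where
  "weight m = qpoch_inf q (q * q ^ m) * qpoch_inf q (- (q * q ^ m))"

text \<open>The Pearson equation \<open>w(x / q) = (1 - x\<^sup>2) w(x)\<close> on the lattice.\<close>
lemma weight_Suc: "weight m = (1 - q ^ (2 * Suc m)) * weight (Suc m)"
proof -
  define a where "a = q * q ^ m"
  have "weight m = (1 - a) * (1 + a) * (qpoch_inf q (a * q) * qpoch_inf q (- (a * q)))"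
    unfolding weight_def a_def[symmetric] qpoch_inf_shift[of a] qpoch_inf_shift[of "- a"]
    by simp
  also have "(1 - a) * (1 + a) = 1 - q ^ (2 * Suc m)"
    by (simp add: a_def algebra_simps power_mult power2_eq_square power_mult_distrib)
  finally show ?thesis by (simp add: weight_def a_def mult_ac)
qed

lemma weight_bounds: "0 \<le> weight m" "weight m \<le> 1"
proof -
  define a where "a = q * q ^ m"
  have a: "0 < a" "a < 1" 
    using power_less_1[of "Suc m"] q_pos by (auto simp: a_def)
  have f: "1 - (a * q ^ i)\<^sup>2 \<in> {0..1}" for i
  proof -
    have "a * q ^ i \<le> 1" "a * q ^ i \<ge> 0"
      using a q_pos q_less_1 by (auto intro!: mult_le_one power_le_one)
    then show ?thesis by (auto simp: power_le_one)
  qed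
  have p: "qpoch q a n * qpoch q (- a) n = (\<Prod>i<n. 1 - (a * q ^ i)\<^sup>2)" for n
    unfolding qpoch_def prod.distrib[symmetric]
    by (rule prod.cong) (auto simp: power2_eq_square algebra_simps)
  have lim: "(\<lambda>n. \<Prod>i<n. 1 - (a * q ^ i)\<^sup>2) \<longlonglongrightarrow> weight m"
    unfolding weight_def a_def[symmetric] p[symmetric] by (intro tendsto_mult qpoch_tendsto)
  show "0 \<le> weight m"
    by (rule LIMSEQ_le_const[OF lim]) (use f in \<open>auto intro!: prod_nonneg\<close>)
  show "weight m \<le> 1"
    by (rule LIMSEQ_le_const2[OF lim]) (use f in \<open>auto intro!: prod_le_1\<close>)
qed

definition lattice_term :: "real poly \<Rightarrow> nat \<Rightarrow> real" where
  "lattice_term p m = q ^ m * (weight m * (poly p (q ^ m) + poly p (- (q ^ m))))"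

text \<open>The Jackson integral against the weight, written \<open>L\<close> in the comments.\<close>
definition hermite_functional :: "real poly \<Rightarrow> real" where
  "hermite_functional p = (1 - q) * (\<Sum>m. lattice_term p m)"

lemma jackson_integral_weight:
  "jackson_integral q (\<lambda>x. poly p x * (qpoch_inf q (q * x) * qpoch_inf q (- (q * x))))
     = hermite_functional p"
  unfolding jackson_integral_def hermite_functional_def lattice_term_def weight_def
  by (simp add: algebra_simps)

lemma summable_lattice_term: "summable (lattice_term p)"
proof -
  have "bounded (poly p ` {-1..1})"
    by (intro compact_imp_bounded compact_continuous_image continuous_intros) auto
  then have "\<exists>B. \<forall>x\<in>{-1..1}. \<bar>poly p x\<bar> \<le> B"
    by (simp add: bounded_iff)
  then obtain B where B: "\<And>x. x \<in> {-1..1} \<Longrightarrow> \<bar>poly p x\<bar> \<le> B"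
    by blast
  have "norm (lattice_term p m) \<le> q ^ m * (2 * B)" for m
  proof -
    have "q ^ m \<in> {-1..1}" "- (q ^ m) \<in> {-1..1}"
      using q_pos q_less_1 power_le_one[of q m] by (auto intro: order_trans[of _ 0])
    then have "\<bar>poly p (q ^ m)\<bar> \<le> B" "\<bar>poly p (- (q ^ m))\<bar> \<le> B" by (auto intro: B)
    then have s: "\<bar>poly p (q ^ m) + poly p (- (q ^ m))\<bar> \<le> 2 * B" by linarith
    have "\<bar>weight m * (poly p (q ^ m) + poly p (- (q ^ m)))\<bar> \<le> 1 * (2 * B)"
      unfolding abs_mult by (intro mult_mono s) (use weight_bounds in auto)
    then show ?thesis
      using q_pos by (simp add: lattice_term_def abs_mult)
  qed
  moreover have "summable (\<lambda>m. q ^ m * (2 * B))"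
    using q_pos q_less_1 by (intro summable_mult2) simp
  ultimately show ?thesis using summable_comparison_test'[of _ 0] by blast
qed

lemma hermite_functional_add:
  "hermite_functional (p + r) = hermite_functional p + hermite_functional r"
proof -
  have "lattice_term (p + r) m = lattice_term p m + lattice_term r m" for m
    by (simp add: lattice_term_def algebra_simps)
  then have "(\<Sum>m. lattice_term (p + r) m) = (\<Sum>m. lattice_term p m) + (\<Sum>m. lattice_term r m)"
    by (simp add: suminf_add[OF summable_lattice_term summable_lattice_term])
  then show ?thesis
    by (simp only: hermite_functional_def distrib_left)
qed

lemma hermite_functional_smult: "hermite_functional (smult c p) = c * hermite_functional p"
proof -
  have "lattice_term (smult c p) m = c * lattice_term p m" for m
    by (simp add: lattice_term_def algebra_simps)
  then have "(\<Sum>m. lattice_term (smult c p) m) = c * (\<Sum>m. lattice_term p m)"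
    by (simp add: suminf_mult[OF summable_lattice_term])
  then show ?thesis
    by (simp only: hermite_functional_def mult.left_commute)
qed

lemma hermite_functional_diff:
  "hermite_functional (p - r) = hermite_functional p - hermite_functional r"
  using hermite_functional_add[of p "smult (-1) r"] hermite_functional_smult[of "-1" r] by simp

lemma hermite_functional_0 [simp]: "hermite_functional 0 = 0"
  using hermite_functional_smult[of 0 0] by simp

lemma hermite_functional_sum:
  "hermite_functional (\<Sum>i\<in>A. f i) = (\<Sum>i\<in>A. hermite_functional (f i))"
  by (induction A rule: infinite_finite_induct) (simp_all add: hermite_functional_add)

text \<open>Summation by parts. By the Pearson equation, \<open>D\<^sub>q\<close> of \<open>p(x) w(x / q)\<close> is \<open>w(x)\<close> times
  \<open>(D\<^sub>q p)(x) - x p(x) / (1 - q)\<close>. Its Jackson integral telescopes: the boundary values at \<open>\<plusminus> 1\<close>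
  vanish because \<open>w(\<plusminus> 1 / q) = 0\<close>, and those at \<open>0\<plusminus>\<close> cancel because the weight is even.\<close>
lemma hermite_functional_X_mult:
  "hermite_functional ([:0, 1:] * p) = (1 - q) * hermite_functional (poly_qderiv p)"
proof -
  \<comment> \<open>the difference of \<open>p(x) w(x / q)\<close> between \<open>x = q\<^sup>m\<close> and \<open>x = - q\<^sup>m\<close>\<close>
  define g where "g m = (1 - q ^ (2 * m)) * weight m * (poly p (q ^ m) - poly p (- (q ^ m)))" for m
  have g_Suc: "g (Suc m) = weight m * (poly p (q * q ^ m) - poly p (- (q * q ^ m)))" for m
    by (simp only: g_def weight_Suc[symmetric] power_Suc)
  have g_0: "g 0 = 0" by (simp add: g_def)
  have "g \<longlonglongrightarrow> 0"
  proof (rule LIMSEQ_imp_Suc)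
    have l: "(\<lambda>m. poly p (q * q ^ m) - poly p (- (q * q ^ m))) \<longlonglongrightarrow> poly p (q * 0) - poly p (- (q * 0))"
      by (intro tendsto_intros power_tendsto_0)
    have l: "(\<lambda>m. \<bar>poly p (q * q ^ m) - poly p (- (q * q ^ m))\<bar>) \<longlonglongrightarrow> 0"
      using tendsto_rabs[OF l] by simp
    show "(\<lambda>m. g (Suc m)) \<longlonglongrightarrow> 0"
    proof (rule tendsto_rabs_zero_cancel, rule tendsto_sandwich[OF _ _ tendsto_const l])
      show "\<forall>\<^sub>F m in sequentially. \<bar>g (Suc m)\<bar> \<le> \<bar>poly p (q * q ^ m) - poly p (- (q * q ^ m))\<bar>"
        by (simp add: g_Suc abs_mult weight_bounds mult_left_le_one_le)
    qed auto
  qed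
  then have "(\<lambda>m. g (Suc m) - g m) sums (0 - g 0)" by (rule telescope_sums)
  then have s0: "(\<lambda>m. g (Suc m) - g m) sums 0" by (simp add: g_0)
  have t: "(q - 1) * lattice_term (poly_qderiv p) m + lattice_term ([:0, 1:] * p) m = g (Suc m) - g m" for m
  proof -
    define x W where "x = q ^ m" and "W = weight m"
    define d1 d2 where "d1 = poly (poly_qderiv p) x" and "d2 = poly (poly_qderiv p) (- x)"
    have e1: "poly p (q * x) = poly p x + (q - 1) * x * d1"
      and e2: "poly p (- (q * x)) = poly p (- x) - (q - 1) * x * d2"
      using poly_qderiv_spec_at[of x p] poly_qderiv_spec_at[of "- x" p]
      by (auto simp: d1_def d2_def)
    have x2: "q ^ (2 * m) = x * x" by (simp add: x_def mult_2 power_add)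
    show ?thesis
      unfolding lattice_term_def g_Suc unfolding g_def x2
      unfolding x_def[symmetric] W_def[symmetric] e1 e2
      by (simp add: d1_def[symmetric] d2_def[symmetric] algebra_simps)
  qed
  have "(\<lambda>m. (q - 1) * lattice_term (poly_qderiv p) m + lattice_term ([:0, 1:] * p) m)
     sums ((q - 1) * (\<Sum>m. lattice_term (poly_qderiv p) m) + (\<Sum>m. lattice_term ([:0, 1:] * p) m))"
    by (intro sums_add sums_mult summable_sums summable_lattice_term)
  then have "(q - 1) * (\<Sum>m. lattice_term (poly_qderiv p) m) + (\<Sum>m. lattice_term ([:0, 1:] * p) m) = 0"
    using s0 sums_unique2 unfolding t by blast
  then have "(\<Sum>m. lattice_term ([:0, 1:] * p) m) = (1 - q) * (\<Sum>m. lattice_term (poly_qderiv p) m)"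
    by (simp add: algebra_simps)
  then show ?thesis by (simp only: hermite_functional_def)
qed

lemma poly_qderiv_X_power:
  "poly_qderiv ([:0, 1:] ^ Suc n) = smult (qnum q (int (Suc n))) ([:0, 1:] ^ n)"
proof (induction n)
  case 0
  show ?case using q_less_1 by (simp add: poly_qderiv_linear qnum_def one_pCons)
next
  case (Suc n)
  have "poly_qderiv ([:0, 1:] ^ Suc (Suc n)) = poly_qderiv ([:0, 1:] * [:0, 1:] ^ Suc n)"
    by (simp only: power_Suc)
  also have "\<dots> = smult (1 + q * qnum q (int (Suc n))) ([:0, 1:] ^ Suc n)"
    unfolding poly_qderiv_X_mult Suc mult_smult_right smult_smult smult_add_left smult_1_left
    by (simp only: power_Suc)
  finally show ?case by (simp only: qnum_Suc')
qed

lemma even_moments: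
  "hermite_functional ([:0, 1:] ^ (2 * k)) = hermite_functional 1 * qpoch (q\<^sup>2) q k"
proof (induction k)
  case 0
  show ?case by (simp add: qpoch_def)
next
  case (Suc k)
  have "hermite_functional ([:0, 1:] ^ (2 * Suc k)) = hermite_functional ([:0, 1:] * [:0, 1:] ^ Suc (2 * k))"
    by simp
  also have "\<dots> = (1 - q) * (qnum q (int (Suc (2 * k))) * hermite_functional ([:0, 1:] ^ (2 * k)))"
    by (simp only: hermite_functional_X_mult poly_qderiv_X_power hermite_functional_smult)
  also have "\<dots> = (1 - q * q ^ (2 * k)) * hermite_functional ([:0, 1:] ^ (2 * k))"
    using q_less_1 by (simp only: qnum_nat power_Suc) simp
  also have "q ^ (2 * k) = (q\<^sup>2) ^ k" by (simp add: power_mult)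
  finally show ?case by (simp only: Suc) (simp add: qpoch_def mult_ac)
qed

text \<open>High even powers concentrate the Jackson integral on the two lattice points \<open>\<plusminus> 1\<close>. Compared with
  \<open>even_moments\<close> this determines the total mass.\<close>
lemma even_moments_tendsto:
  "(\<lambda>k. hermite_functional ([:0, 1:] ^ (2 * k))) \<longlonglongrightarrow> 2 * (1 - q) * weight 0"
proof -
  let ?t = "\<lambda>k. lattice_term ([:0, 1:] ^ (2 * k))"
  have t: "?t k m = 2 * q ^ m * weight m * (q ^ m) ^ (2 * k)" for k m
    by (simp add: lattice_term_def poly_power)
  have split: "(\<Sum>m. ?t k m) = 2 * weight 0 + (\<Sum>m. ?t k (Suc m))" for k
    using suminf_split_head[OF summable_lattice_term[of "[:0, 1:] ^ (2 * k)"]] t[of k 0] by simp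
  have sm: "summable (\<lambda>m. ?t k (Suc m))" for k
    using summable_lattice_term by (simp add: summable_Suc_iff)
  have nonneg: "0 \<le> (\<Sum>m. ?t k (Suc m))" for k
    using weight_bounds q_pos by (intro suminf_nonneg sm) (simp add: t)
  have upper: "(\<Sum>m. ?t k (Suc m)) \<le> (\<Sum>m. q ^ m * (2 * q ^ k))" for k
  proof (rule suminf_le[OF _ sm])
    show "summable (\<lambda>m. q ^ m * (2 * q ^ k))"
      using q_pos q_less_1 by (intro summable_mult2) simp
    fix m
    have "(q ^ Suc m) ^ (2 * k) = q ^ (Suc m * (2 * k))" by (simp only: power_mult)
    also have "\<dots> \<le> q ^ k"
      using q_pos q_less_1 by (intro power_decreasing) auto
    finally have a: "(q ^ Suc m) ^ (2 * k) \<le> q ^ k" .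
    have b: "q ^ Suc m * weight (Suc m) \<le> q ^ m * 1"
      using q_pos q_less_1 weight_bounds by (intro mult_mono power_decreasing) auto
    have "q ^ Suc m * weight (Suc m) * (q ^ Suc m) ^ (2 * k) \<le> (q ^ m * 1) * q ^ k"
      using q_pos weight_bounds by (intro mult_mono a b) auto
    then show "?t k (Suc m) \<le> q ^ m * (2 * q ^ k)" unfolding t by simp
  qed
  have "(\<Sum>m. q ^ m * (2 * q ^ k)) = (\<Sum>m. q ^ m) * (2 * q ^ k)" for k
    using q_pos q_less_1 by (intro suminf_mult2[symmetric]) simp
  moreover have "(\<lambda>k. (\<Sum>m. q ^ m) * (2 * q ^ k)) \<longlonglongrightarrow> (\<Sum>m. q ^ m) * (2 * 0)"
    by (intro tendsto_mult tendsto_const power_tendsto_0)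
  ultimately have "(\<lambda>k. (\<Sum>m. q ^ m * (2 * q ^ k))) \<longlonglongrightarrow> 0"
    by simp
  then have "(\<lambda>k. (\<Sum>m. ?t k (Suc m))) \<longlonglongrightarrow> 0"
    by (rule tendsto_sandwich[OF _ _ tendsto_const, rotated 2]) (use nonneg upper in auto)
  then have "(\<lambda>k. (1 - q) * (2 * weight 0 + (\<Sum>m. ?t k (Suc m)))) \<longlonglongrightarrow> (1 - q) * (2 * weight 0 + 0)"
    by (intro tendsto_intros)
  then show ?thesis unfolding hermite_functional_def split by (simp add: algebra_simps)
qed

text \<open>The finite form of Euler's identity \<open>(q; q\<^sup>2)\<^sub>\<infinity> (-q; q)\<^sub>\<infinity> = 1\<close>.\<close>
lemma qpoch_double: "qpoch (q\<^sup>2) q k * (qpoch q (- q) k * qpoch q q k) = qpoch q q (2 * k)"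
proof (induction k)
  case 0
  show ?case by (simp add: qpoch_def)
next
  case (Suc k)
  define x where "x = q ^ k"
  have e: "(q\<^sup>2) ^ k = x * x" "q ^ (2 * k) = x * x"
    by (simp_all add: x_def mult_2 power_add flip: power_mult)
  have "qpoch (q\<^sup>2) q (Suc k) * (qpoch q (- q) (Suc k) * qpoch q q (Suc k))
     = (qpoch (q\<^sup>2) q k * (qpoch q (- q) k * qpoch q q k)) * ((1 - q * (x * x)) * ((1 + q * x) * (1 - q * x)))"
    by (simp add: qpoch_def e x_def[symmetric])
  also have "\<dots> = qpoch q q (2 * Suc k)"
    unfolding Suc by (simp add: qpoch_Suc e) (simp add: algebra_simps)
  finally show ?case .
qed

lemma hermite_functional_1: "hermite_functional 1 = sqnorm q 0"
proof -
  let ?I = "qpoch_inf q q" and ?J = "qpoch_inf q (- q)"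
  have e: "hermite_functional ([:0, 1:] ^ (2 * k)) * (qpoch q (- q) k * qpoch q q k)
      = hermite_functional 1 * qpoch q q (2 * k)" for k
    by (simp only: even_moments mult.assoc qpoch_double)
  have "(\<lambda>k. hermite_functional ([:0, 1:] ^ (2 * k)) * (qpoch q (- q) k * qpoch q q k))
      \<longlonglongrightarrow> 2 * (1 - q) * weight 0 * (?J * ?I)"
    by (intro tendsto_mult even_moments_tendsto qpoch_tendsto)
  moreover have "(\<lambda>k. hermite_functional 1 * qpoch q q (2 * k)) \<longlonglongrightarrow> hermite_functional 1 * ?I"
    by (intro tendsto_mult_left LIMSEQ_subseq_LIMSEQ[OF qpoch_tendsto, unfolded comp_def])
       (auto simp: strict_mono_def)
  ultimately have "2 * (1 - q) * weight 0 * (?J * ?I) = hermite_functional 1 * ?I"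
    unfolding e by (rule LIMSEQ_unique)
  then have "hermite_functional 1 = 2 * (1 - q) * weight 0 * ?J"
    using qpoch_inf_pos[of q] q_less_1 by (simp add: mult.assoc)
  moreover have "qpoch_inf q (- 1) = 2 * ?J"
    using qpoch_inf_shift[of "- 1"] by simp
  ultimately show ?thesis
    by (simp add: sqnorm_def weight_def qpoch_def numeral_2_eq_2)
qed

lemma sqnorm_pos: "sqnorm q (int n) > 0"
proof -
  have "qpoch_inf q q > 0" "qpoch_inf q (- 1) > 0" "qpoch_inf q (- q) > 0"
    using q_pos q_less_1 by (auto intro!: qpoch_inf_pos)
  then show ?thesis
    using q_pos q_less_1 qpoch_q_pos[of n] by (simp add: sqnorm_def)
qed

lemma sqnorm_Suc: "sqnorm q (int (Suc n)) = gam q (int (Suc n)) * sqnorm q (int n)"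
  unfolding gam_Suc by (simp add: sqnorm_def qpoch_Suc choose_two_Suc power_add mult_ac del: of_nat_Suc)

text \<open>Applying the functional to \<open>x H\<^sub>n\<close> by parts and by the recurrence gives
  \<open>L(H\<^sub>n\<^sub>+\<^sub>1) = (1 - q\<^sup>n - \<gamma>\<^sub>n) L(H\<^sub>n\<^sub>-\<^sub>1) = (1 - q\<^sup>n) (1 - q\<^bsup>n-1\<^esup>) L(H\<^sub>n\<^sub>-\<^sub>1)\<close>. The factor is zero at \<open>n = 1\<close>, so
  the total mass does not propagate.\<close>
lemma hermite_functional_hermite: "hermite_functional (hermite_poly (Suc n)) = 0"
proof (induction n rule: less_induct)
  case (less n)
  show ?case
  proof (cases n)
    case 0
    then show ?thesis using hermite_functional_X_mult[of 1] by simp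
  next
    case (Suc k)
    have "hermite_functional (hermite_poly (Suc (Suc k)))
       = (1 - q ^ Suc k) * hermite_functional (hermite_poly k)
          - gam q (int (Suc k)) * hermite_functional (hermite_poly k)"
      unfolding hermite_poly.simps hermite_functional_diff hermite_functional_X_mult
        poly_qderiv_hermite hermite_functional_smult qnum_nat
      using q_less_1 by simp
    also have "\<dots> = (1 - q ^ Suc k) * (1 - q ^ k) * hermite_functional (hermite_poly k)"
      unfolding gam_Suc by (simp add: algebra_simps)
    also have "\<dots> = 0"
      using less.IH[of "k - 1"] Suc by (cases k) auto
    finally show ?thesis using Suc by simp
  qed
qed

text \<open>With \<open>L(H\<^sub>n) = 0\<close> for \<open>n \<ge> 1\<close> known, orthogonality is a consequence of the recurrence: moving a
  factor \<open>x\<close> from one polynomial to the other lowers \<open>m\<close>, and the norms obey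
  \<open>\<parallel>H\<^sub>n\<^sub>+\<^sub>1\<parallel>\<^sup>2 = \<gamma>\<^sub>n\<^sub>+\<^sub>1 \<parallel>H\<^sub>n\<parallel>\<^sup>2\<close>.\<close>
lemma hermite_orthogonal:
  "hermite_functional (hermite_poly m * hermite_poly n) = (if m = n then sqnorm q (int m) else 0)"
proof (induction m arbitrary: n rule: hermite_poly.induct)
  case 1
  show ?case
    using hermite_functional_1 hermite_functional_hermite by (cases n) auto
next
  case 2
  have "hermite_functional (hermite_poly (Suc 0) * hermite_poly n)
     = hermite_functional (hermite_poly (Suc n)) + gam q (int n) * hermite_functional (hermite_poly (n - 1))"
    by (simp only: hermite_poly.simps hermite_recurrence hermite_functional_add hermite_functional_smult)
  moreover have "gam q (int n) * hermite_functional (hermite_poly (n - 1)) = (if n = 1 then sqnorm q 1 else 0)"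
  proof -
    consider "n = 0" | "n = 1" | k where "n = Suc (Suc k)" by (metis One_nat_def not0_implies_Suc)
    then show ?thesis
      using sqnorm_Suc[of 0] hermite_functional_hermite by cases (auto simp: hermite_functional_1 mult_ac)
  qed
  ultimately show ?case using hermite_functional_hermite by auto
next
  case (3 m)
  let ?N = "\<lambda>n. sqnorm q (int n)" and ?g = "\<lambda>n. gam q (int n)"
  have "hermite_poly (Suc (Suc m)) * hermite_poly n
      = hermite_poly (Suc m) * ([:0, 1:] * hermite_poly n) - smult (?g (Suc m)) (hermite_poly m * hermite_poly n)"
    unfolding hermite_poly.simps left_diff_distrib mult_smult_left by (simp only: mult.left_commute mult.assoc)
  also have "\<dots> = hermite_poly (Suc m) * hermite_poly (Suc n)
      + smult (?g n) (hermite_poly (Suc m) * hermite_poly (n - 1))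
      - smult (?g (Suc m)) (hermite_poly m * hermite_poly n)"
    unfolding hermite_recurrence distrib_left mult_smult_right ..
  finally have "hermite_functional (hermite_poly (Suc (Suc m)) * hermite_poly n)
     = (if m = n then ?N (Suc m) else 0) + ?g n * (if Suc m = n - 1 then ?N (Suc m) else 0)
       - ?g (Suc m) * (if m = n then ?N m else 0)"
    by (simp add: hermite_functional_add hermite_functional_diff hermite_functional_smult 3 del: hermite_poly.simps)
  also have "\<dots> = (if Suc (Suc m) = n then ?N (Suc (Suc m)) else 0)"
    using sqnorm_Suc[of m] sqnorm_Suc[of "Suc m"] by (cases n) auto
  finally show ?case .
qed

section \<open>The q-Taylor form of the Christoffel-Darboux kernel\<close>

lemma qfact_0: "qfact q 0 = 1"
  by (simp add: qfact_def)

lemma qbinomial_Pascal: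
  "qfact q (Suc (k + Suc r)) / (qfact q (Suc k) * qfact q (Suc r))
     = qfact q (k + Suc r) / (qfact q (Suc k) * qfact q r)
       + q ^ Suc r * (qfact q (k + Suc r) / (qfact q k * qfact q (Suc r)))"
proof -
  let ?Q = "\<lambda>n. qnum q (int n)"
  define K R where "K = ?Q (Suc k)" and "R = ?Q (Suc r)"
  have "?Q (Suc (k + Suc r)) = R + q ^ Suc r * K"
    using q_less_1 unfolding K_def R_def qnum_nat by (simp add: field_simps power_add)
  then have t: "qfact q (Suc (k + Suc r)) = qfact q (k + Suc r) * (R + q ^ Suc r * K)"
    by (simp only: qfact_Suc)
  have "K > 0" "R > 0" "qfact q k > 0" "qfact q r > 0"
    unfolding K_def R_def by (rule qnum_pos qfact_pos, simp)+ (rule qfact_pos)+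
  then show ?thesis
    unfolding t qfact_Suc[of k] qfact_Suc[of r] K_def[symmetric] R_def[symmetric]
    by (simp add: divide_simps) (simp add: algebra_simps)
qed

text \<open>The \<open>q\<close>-binomial theorem. The coefficients \<open>b\<close> in the proof are cut off at \<open>k > m\<close>, where truncated
  subtraction would make the quotient of factorials nonzero.\<close>
lemma qsub_pow_eq_prod: "qsub_pow q x y m = (\<Prod>i<m. x - q ^ i * y)"
proof (induction m)
  case 0
  show ?case by (simp add: qsub_pow_def qfact_def numeral_2_eq_2)
next
  case (Suc m)
  define b where "b m k = (if k \<le> m then qfact q m / (qfact q k * qfact q (m - k)) else 0)" for m k
  define c where "c k = q ^ (k choose 2) * (- y) ^ k" for k
  have c_Suc: "c (Suc k) = q ^ k * (- y) * c k" for k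
    by (simp add: c_def choose_two_Suc power_add)
  have b_0: "b n 0 = 1" for n
    using qfact_pos[of n] by (simp add: b_def qfact_0)
  have pascal: "b (Suc m) (Suc k) = b m (Suc k) + q ^ (m - k) * b m k" if "k \<le> m" for k
  proof (cases "k = m")
    case True
    then show ?thesis using qfact_pos[of m] qfact_pos[of "Suc m"] by (simp add: b_def qfact_0)
  next
    case False
    with that have "k < m" by simp
    then obtain r where "m = Suc (k + r)" using less_imp_Suc_add by blast
    then have "m = k + Suc r" by simp
    then show ?thesis using qbinomial_Pascal[of k r] by (simp add: b_def)
  qed
  have expand: "qsub_pow q x y n = (\<Sum>k\<le>n. b n k * c k * x ^ (n - k))" for n
    by (simp add: qsub_pow_def b_def c_def mult.assoc)
  have "qsub_pow q x y (Suc m)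
      = x ^ Suc m * c 0 + (\<Sum>k\<le>m. (b m (Suc k) + q ^ (m - k) * b m k) * c (Suc k) * x ^ (m - k))"
    unfolding expand by (subst sum.atMost_Suc_shift) (simp add: b_0 pascal)
  also have "\<dots> = (x ^ Suc m * c 0 + (\<Sum>k\<le>m. b m (Suc k) * c (Suc k) * x ^ (m - k)))
      + (\<Sum>k\<le>m. (q ^ (m - k) * q ^ k) * (- y) * (b m k * c k * x ^ (m - k)))"
    by (simp add: sum.distrib[symmetric] c_Suc algebra_simps)
  also have "x ^ Suc m * c 0 + (\<Sum>k\<le>m. b m (Suc k) * c (Suc k) * x ^ (m - k))
      = (\<Sum>k\<le>Suc m. b m k * c k * x ^ (Suc m - k))"
    by (subst sum.atMost_Suc_shift) (simp add: b_0)
  also have "\<dots> = (\<Sum>k\<le>m. b m k * c k * x ^ (Suc m - k))"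
    by (simp add: b_def)
  also have "\<dots> = x * qsub_pow q x y m"
    unfolding expand sum_distrib_left by (rule sum.cong) (simp_all add: Suc_diff_le)
  also have "(\<Sum>k\<le>m. (q ^ (m - k) * q ^ k) * (- y) * (b m k * c k * x ^ (m - k)))
      = - (q ^ m * y) * qsub_pow q x y m"
    unfolding expand sum_distrib_left by (rule sum.cong) (simp_all flip: power_add)
  finally show ?case using Suc by (simp add: algebra_simps)
qed

lemma qsub_pow_Suc: "qsub_pow q x y (Suc m) = (x - q ^ m * y) * qsub_pow q x y m"
  by (simp add: qsub_pow_eq_prod)

lemma christoffel_darboux:
  "(x - y) * (\<Sum>k<Suc n. poly (hermite_poly k) x * poly (hermite_poly k) y / sqnorm q (int k))
     = (poly (hermite_poly (Suc n)) x * poly (hermite_poly n) y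
        - poly (hermite_poly n) x * poly (hermite_poly (Suc n)) y) / sqnorm q (int n)"
proof (induction n)
  case 0
  show ?case by simp
next
  case (Suc n)
  define N g where "N = sqnorm q (int n)" and "g = gam q (int (Suc n))"
  have N: "N > 0" "g > 0" unfolding N_def g_def by (rule sqnorm_pos gam_Suc_pos)+
  have NS: "sqnorm q (int (Suc n)) = g * N" by (simp only: sqnorm_Suc N_def g_def)
  have r: "poly (hermite_poly (Suc (Suc n))) t
      = t * poly (hermite_poly (Suc n)) t - g * poly (hermite_poly n) t" for t
    by (simp add: g_def)
  show ?case
    unfolding sum.lessThan_Suc[of _ "Suc n"] distrib_left Suc.IH NS r N_def[symmetric]
    using N by (simp add: field_simps)
qed

text \<open>The \<open>q\<close>-Leibniz rule with a linear factor: each differentiation replaces \<open>y\<close> by \<open>q y\<close> in the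
  factor \<open>x - y\<close>, and the constants \<open>1, q, \<dots>, q\<^sup>j\<close> released on the way add up to \<open>[j + 1]\<close>.\<close>
lemma poly_qderiv_funpow_linear_mult:
  "(poly_qderiv ^^ Suc j) ([:x, -1:] * g)
     = [:x, - (q ^ Suc j):] * (poly_qderiv ^^ Suc j) g
       - smult (qnum q (int (Suc j))) ((poly_qderiv ^^ j) g)"
proof (induction j)
  case 0
  show ?case using q_less_1
    by (simp only: funpow.simps o_apply id_apply poly_qderiv_mult poly_qderiv_linear)
       (simp add: pcompose_pCons qnum_def)
next
  case (Suc j)
  let ?u = "(poly_qderiv ^^ Suc j) g"
  have "(poly_qderiv ^^ Suc (Suc j)) ([:x, -1:] * g)
      = poly_qderiv ([:x, - (q ^ Suc j):] * ?u - smult (qnum q (int (Suc j))) ((poly_qderiv ^^ j) g))"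
    unfolding Suc[symmetric] by simp
  also have "\<dots> = [:x, - (q ^ Suc (Suc j)):] * poly_qderiv ?u - smult (q ^ Suc j) ?u
      - smult (qnum q (int (Suc j))) ?u"
  proof -
    have "poly_qderiv ([:x, - b:] * u) = [:x, - (q * b):] * poly_qderiv u - smult b u" for b u
      by (simp only: poly_qderiv_mult poly_qderiv_linear) (simp add: pcompose_pCons mult.commute)
    then show ?thesis by (simp only: poly_qderiv_diff poly_qderiv_smult power_Suc funpow.simps o_apply)
  qed
  also have "\<dots> = [:x, - (q ^ Suc (Suc j)):] * poly_qderiv ?u
      - smult (q ^ Suc j + qnum q (int (Suc j))) ?u"
    by (simp only: smult_add_left diff_diff_eq)
  also have "q ^ Suc j + qnum q (int (Suc j)) = qnum q (int (Suc (Suc j)))"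
    by (simp only: qnum_Suc[of "Suc j"] add.commute)
  finally show ?case by simp
qed

text \<open>The Leibniz rule expresses \<open>(x - q\<^sup>j y) (D\<^sub>q\<^sup>j g)(y)\<close> through \<open>D\<^sub>q\<^sup>j\<close> of \<open>(x - y) g(y)\<close> and the previous
  derivative of \<open>g\<close>; the products of the factors \<open>x - q\<^sup>i y\<close> accumulated by iterating this are the
  \<open>q\<close>-subtraction powers. This avoids differentiating \<open>1 / (x - y)\<close>.\<close>
lemma qTaylor_of_linear_mult:
  "qsub_pow q x y (Suc j) * poly ((poly_qderiv ^^ j) g) y / qfact q j
     = (\<Sum>k\<le>j. poly ((poly_qderiv ^^ k) ([:x, -1:] * g)) y / qfact q k * qsub_pow q x y k)"
proof (induction j)
  case 0
  show ?case by (simp add: qsub_pow_eq_prod qfact_0 algebra_simps)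
next
  case (Suc j)
  define Q where "Q = qnum q (int (Suc j))"
  have pos: "Q > 0" "qfact q j > 0" unfolding Q_def by (rule qnum_pos, simp) (rule qfact_pos)
  let ?d = "\<lambda>k. poly ((poly_qderiv ^^ k) g) y"
  have l: "poly ((poly_qderiv ^^ Suc j) ([:x, -1:] * g)) y = (x - q ^ Suc j * y) * ?d (Suc j) - Q * ?d j"
    unfolding poly_qderiv_funpow_linear_mult Q_def by (simp add: algebra_simps)
  show ?case
    unfolding sum.atMost_Suc Suc[symmetric] l qsub_pow_Suc[of _ _ "Suc j"] qfact_Suc Q_def[symmetric]
    using pos by (simp add: field_simps)
qed

lemma kernel_eq_sum:
  "kernel q (int n - 1) i l x y
     = (\<Sum>k<n. poly ((poly_qderiv ^^ i) (hermite_poly k)) x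
          * poly ((poly_qderiv ^^ l) (hermite_poly k)) y / sqnorm q (int k))"
proof -
  have "{0..int n - 1} = int ` {..<n}"
    unfolding lessThan_atLeast0 image_int_atLeastLessThan by auto
  then show ?thesis
    unfolding kernel_def by (simp add: sum.reindex qHermite_eq_poly qderiv_funpow_poly)
qed

text \<open>The Christoffel-Darboux formula makes \<open>x - y\<close> times the kernel, with the kernel a polynomial \<open>g\<close> in \<open>y\<close>, a
  combination of \<open>H\<^sub>n(y)\<close> and \<open>H\<^sub>n\<^sub>+\<^sub>1(y)\<close>. The \<open>q\<close>-Taylor identity for \<open>g\<close> then recovers \<open>D\<^sub>q\<^sup>j g\<close>.\<close>
lemma kernel_eq_coefs:
  assumes "qsub_pow q x y (j + 1) \<noteq> 0"
  shows "kernel q (int (Suc n) - 1) 0 j x y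
     = Acoef q j (int (Suc n)) x y * poly (hermite_poly (Suc n)) x
       + Bcoef q j (int (Suc n)) x y * poly (hermite_poly n) x"
proof -
  define N where "N = sqnorm q (int n)"
  define g where "g = (\<Sum>k<Suc n. smult (poly (hermite_poly k) x / sqnorm q (int k)) (hermite_poly k))"
  define u v where "u = poly (hermite_poly (Suc n)) x" and "v = poly (hermite_poly n) x"
  have N: "N > 0" unfolding N_def by (rule sqnorm_pos)
  let ?S = "\<lambda>m. \<Sum>k\<le>j. poly ((poly_qderiv ^^ k) (hermite_poly m)) y / qfact q k * qsub_pow q x y k"
  have "poly ([:x, -1:] * g) t = poly (smult (u / N) (hermite_poly n) - smult (v / N) (hermite_poly (Suc n))) t"
    for t
  proof -
    have "poly ([:x, -1:] * g) t
      = (x - t) * (\<Sum>k<Suc n. poly (hermite_poly k) x * poly (hermite_poly k) t / sqnorm q (int k))"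
      by (simp add: g_def poly_sum algebra_simps del: sum.lessThan_Suc)
    also have "\<dots> = (u * poly (hermite_poly n) t - v * poly (hermite_poly (Suc n)) t) / N"
      unfolding christoffel_darboux u_def v_def N_def ..
    finally show ?thesis by (simp add: diff_divide_distrib)
  qed
  then have cd: "[:x, -1:] * g = smult (u / N) (hermite_poly n) - smult (v / N) (hermite_poly (Suc n))"
    by (intro iffD1[OF poly_eq_poly_eq_iff] ext)
  have "poly ((poly_qderiv ^^ j) g) y
      = (\<Sum>k<Suc n. poly (hermite_poly k) x / sqnorm q (int k) * poly ((poly_qderiv ^^ j) (hermite_poly k)) y)"
    by (simp only: g_def poly_qderiv_funpow_sum poly_qderiv_funpow_smult poly_sum poly_smult)
  then have "kernel q (int (Suc n) - 1) 0 j x y = poly ((poly_qderiv ^^ j) g) y"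
    by (simp only: kernel_eq_sum) simp
  also have "\<dots> = qfact q j / qsub_pow q x y (Suc j)
      * (\<Sum>k\<le>j. poly ((poly_qderiv ^^ k) ([:x, -1:] * g)) y / qfact q k * qsub_pow q x y k)"
    unfolding qTaylor_of_linear_mult[symmetric] using assms qfact_pos[of j] by simp
  also have "(\<Sum>k\<le>j. poly ((poly_qderiv ^^ k) ([:x, -1:] * g)) y / qfact q k * qsub_pow q x y k)
      = u / N * ?S n - v / N * ?S (Suc n)"
    unfolding cd poly_qderiv_funpow_diff poly_qderiv_funpow_smult poly_diff poly_smult sum_distrib_left
      sum_subtractf[symmetric]
    by (rule sum.cong) (simp_all add: diff_divide_distrib algebra_simps del: hermite_poly.simps)
  finally have K: "kernel q (int (Suc n) - 1) 0 j x y
      = qfact q j / qsub_pow q x y (Suc j) * (u / N * ?S n - v / N * ?S (Suc n))" .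
  have i: "int (Suc n) - 1 = int n" by simp
  have A: "Acoef q j (int (Suc n)) x y = qfact q j / (N * qsub_pow q x y (Suc j)) * ?S n"
    unfolding Acoef_def i qHermite_eq_poly qderiv_funpow_poly N_def by simp
  have B: "Bcoef q j (int (Suc n)) x y = - (qfact q j / (N * qsub_pow q x y (Suc j))) * ?S (Suc n)"
    unfolding Bcoef_def i qHermite_eq_poly qderiv_funpow_poly N_def by simp
  show ?thesis
    unfolding K A B u_def[symmetric] v_def[symmetric] by (simp add: algebra_simps diff_divide_distrib)
qed

lemma qfall_Suc: "qfall q n (Suc k) = qfall q n k * qnum q (n - int k)"
proof -
  have e: "int (Suc k) * n - int (Suc k choose 2) = (int k * n - int (k choose 2)) + (n - int k)"
    by (simp add: choose_two_Suc algebra_simps)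
  have p: "q powi (- n) * q ^ k = inverse (q powi (n - int k))"
    using q_pos by (simp add: power_int_minus power_int_diff field_simps)
  show ?thesis
    unfolding qfall_def qpoch_Suc e p qnum_def
    using q_pos q_less_1 by (simp add: power_int_add divide_simps) (simp add: algebra_simps)
qed

lemma qderiv_funpow_qHermite:
  "(qderiv q ^^ j) (qHermite q n) = (\<lambda>x. qfall q n j * qHermite q (n - int j) x)"
proof (induction j)
  case 0
  show ?case by (simp add: qfall_def qpoch_def numeral_2_eq_2)
next
  case (Suc j)
  define m where "m = n - int j"
  have "qderiv q (\<lambda>x. c * qHermite q m x) = (\<lambda>x. c * (qnum q m * qHermite q (m - 1) x))" for c
  proof (cases "m \<ge> 0")
    case True
    then obtain k where k: "m = int k" using zero_le_imp_eq_int by blast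
    have "(\<lambda>x. c * qHermite q m x) = poly (smult c (hermite_poly k))"
      by (simp add: k qHermite_eq_poly fun_eq_iff)
    then have "qderiv q (\<lambda>x. c * qHermite q m x) = qderiv q (poly (smult c (hermite_poly k)))"
      by simp
    also have "\<dots> = (\<lambda>x. c * (qnum q m * poly (hermite_poly (k - 1)) x))"
      by (simp add: qderiv_poly poly_qderiv_smult poly_qderiv_hermite k fun_eq_iff)
    also have "\<dots> = (\<lambda>x. c * (qnum q m * qHermite q (m - 1) x))"
      using k qHermite_eq_poly[of "k - 1"] by (cases k) (auto simp: qnum_def)
    finally show ?thesis .
  next
    case False
    have "(\<lambda>x. 0) = poly (0 :: real poly)" by (simp add: fun_eq_iff)
    then have "qderiv q (\<lambda>x. 0) = (\<lambda>x. 0)" by (simp add: qderiv_poly)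
    then show ?thesis using False by (simp add: qHermite_def)
  qed
  then show ?case
    using Suc by (simp add: qfall_Suc m_def algebra_simps)
qed

lemma poly_qderiv_funpow_hermite:
  "poly ((poly_qderiv ^^ j) (hermite_poly n)) x = qfall q (int n) j * qHermite q (int n - int j) x"
  using fun_cong[OF qderiv_funpow_qHermite[of j "int n"], of x]
  by (simp add: qHermite_eq_poly qderiv_funpow_poly)

end

section \<open>Connection with the Sobolev-type polynomials\<close>

lemma monic_basis_expansion:
  fixes B :: "nat \<Rightarrow> real poly"
  assumes B: "\<And>n. degree (B n) = n" "\<And>n. lead_coeff (B n) = 1"
    and "\<And>i. i \<ge> n \<Longrightarrow> coeff p i = 0"
  shows "\<exists>c. p = (\<Sum>k<n. smult (c k) (B k))"
  using assms(3)
proof (induction n arbitrary: p)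
  case 0
  then show ?case by (simp add: poly_eq_iff)
next
  case (Suc n)
  let ?r = "p - smult (coeff p n) (B n)"
  have "coeff ?r i = 0" if "i \<ge> n" for i
  proof (cases "i = n")
    case True
    then show ?thesis using B[of n] by simp
  next
    case False
    then show ?thesis using that Suc.prems[of i] B(1)[of n] by (simp add: coeff_eq_0)
  qed
  then obtain c where c: "?r = (\<Sum>k<n. smult (c k) (B k))" using Suc.IH[of ?r] by blast
  have "p = (\<Sum>k<Suc n. smult ((c(n := coeff p n)) k) (B k))"
    using c by (simp add: algebra_simps)
  then show ?case by blast
qed

context q_in_unit_interval begin

lemma sobolev_inner_poly:
  "sobolev_inner q \<alpha> lam j (poly p) (poly r)
     = hermite_functional (p * r) + lam * poly ((poly_qderiv ^^ j) p) \<alpha> * poly ((poly_qderiv ^^ j) r) \<alpha>"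
  using jackson_integral_weight[of "p * r"] by (simp add: sobolev_inner_def qderiv_funpow_poly)

lemma sobolev_inner_sum_smult:
  "sobolev_inner q \<alpha> lam j (poly p) (poly (\<Sum>i\<in>A. smult (c i) (r i)))
     = (\<Sum>i\<in>A. c i * sobolev_inner q \<alpha> lam j (poly p) (poly (r i)))"
  unfolding sobolev_inner_poly
  by (simp add: sum_distrib_left hermite_functional_sum hermite_functional_smult poly_qderiv_funpow_sum
      poly_qderiv_funpow_smult poly_sum sum.distrib algebra_simps)

text \<open>\<open>P\<^sub>n\<close> is Sobolev-orthogonal to every \<open>H\<^sub>k\<close> with \<open>k < n\<close>, hence
  \<open>L(P\<^sub>n H\<^sub>k) = - \<lambda> (D\<^sub>q\<^sup>j P\<^sub>n)(\<alpha>) (D\<^sub>q\<^sup>j H\<^sub>k)(\<alpha>)\<close>, and dividing by the norm gives the coordinates of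
  \<open>P\<^sub>n - H\<^sub>n\<close>. The unknown number \<open>(D\<^sub>q\<^sup>j P\<^sub>n)(\<alpha>)\<close> is found by applying \<open>D\<^sub>q\<^sup>j\<close> at \<open>\<alpha>\<close> to the resulting
  expansion; the equation for it is solvable since \<open>1 + \<lambda> K > 0\<close>.\<close>
lemma sobolev_connection:
  assumes lam: "lam > 0" and P: "sobolev_polys q \<alpha> lam j P"
  shows "poly (P n) x = qHermite q (int n) x - ccoef q \<alpha> lam j (int n) * kernel q (int n - 1) 0 j x \<alpha>"
proof -
  let ?d = "\<lambda>p. poly ((poly_qderiv ^^ j) p) \<alpha>"
  have deg: "degree (P m) = m" "lead_coeff (P m) = 1" for m
    using P unfolding sobolev_polys_def by blast+
  have orth: "sobolev_inner q \<alpha> lam j (poly (P m)) (poly (P k)) = 0" if "m \<noteq> k" for m k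
    using P that by (auto simp: sobolev_polys_def)
  have hd: "degree (hermite_poly m) = m" "lead_coeff (hermite_poly m) = 1" for m
    using degree_lead_coeff_hermite by blast+
  have orth_h: "hermite_functional (P n * hermite_poly k) = - (lam * ?d (P n) * ?d (hermite_poly k))"
    if "k < n" for k
  proof -
    have "\<exists>c. hermite_poly k = (\<Sum>i<n. smult (c i) (P i))"
      using that hd[of k] by (intro monic_basis_expansion deg coeff_eq_0) simp
    then obtain c where "hermite_poly k = (\<Sum>i<n. smult (c i) (P i))" by blast
    then have "sobolev_inner q \<alpha> lam j (poly (P n)) (poly (hermite_poly k)) = 0"
      by (simp only: sobolev_inner_sum_smult) (simp add: orth)
    then show ?thesis by (simp add: sobolev_inner_poly)
  qed
  have "\<exists>a. P n - hermite_poly n = (\<Sum>k<n. smult (a k) (hermite_poly k))"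
  proof (intro monic_basis_expansion hd)
    fix i assume "i \<ge> n"
    then show "coeff (P n - hermite_poly n) i = 0"
      using deg[of n] hd[of n] by (cases "i = n") (auto simp: coeff_eq_0)
  qed
  then obtain a where a: "P n - hermite_poly n = (\<Sum>k<n. smult (a k) (hermite_poly k))" by blast
  have a_eq: "a k = - (lam * ?d (P n)) * (?d (hermite_poly k) / sqnorm q (int k))" if "k < n" for k
  proof -
    have "hermite_functional (P n * hermite_poly k)
      = hermite_functional (hermite_poly n * hermite_poly k)
        + hermite_functional ((\<Sum>i<n. smult (a i) (hermite_poly i)) * hermite_poly k)"
      unfolding a[symmetric] hermite_functional_add[symmetric] by (simp add: algebra_simps)
    also have "\<dots> = (\<Sum>i<n. a i * (if i = k then sqnorm q (int i) else 0))"
      using that by (simp add: sum_distrib_right hermite_functional_sum hermite_functional_smult hermite_orthogonal)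
    also have "\<dots> = a k * sqnorm q (int k)"
      using that by (simp add: mult_delta_right)
    finally show ?thesis using orth_h[OF that] sqnorm_pos[of k] by (simp add: field_simps)
  qed
  have P_eq: "P n = hermite_poly n
      - smult (lam * ?d (P n)) (\<Sum>k<n. smult (?d (hermite_poly k) / sqnorm q (int k)) (hermite_poly k))"
  proof -
    have "(\<Sum>k<n. smult (a k) (hermite_poly k))
      = (\<Sum>k<n. - smult (lam * ?d (P n)) (smult (?d (hermite_poly k) / sqnorm q (int k)) (hermite_poly k)))"
      by (rule sum.cong) (simp_all add: a_eq)
    then show ?thesis using a by (simp add: smult_sum_right sum_negf algebra_simps)
  qed
  define K where "K = kernel q (int n - 1) j j \<alpha> \<alpha>"
  have K: "K = (\<Sum>k<n. ?d (hermite_poly k) / sqnorm q (int k) * ?d (hermite_poly k))"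
    unfolding K_def kernel_eq_sum by simp
  have "K \<ge> 0"
    unfolding K using sqnorm_pos by (intro sum_nonneg) (simp add: less_imp_le)
  then have pos: "1 + lam * K > 0" using lam by (simp add: add_pos_nonneg)
  have "?d (P n) = ?d (hermite_poly n) - lam * ?d (P n) * K"
    by (subst P_eq) (simp add: poly_qderiv_funpow_diff poly_qderiv_funpow_smult poly_qderiv_funpow_sum poly_sum K)
  then have "?d (P n) = ?d (hermite_poly n) / (1 + lam * K)"
    using pos by (simp add: field_simps)
  then have c: "ccoef q \<alpha> lam j (int n) = lam * ?d (P n)"
    unfolding ccoef_def K_def[symmetric] poly_qderiv_funpow_hermite by simp
  show ?thesis
    unfolding c kernel_eq_sum
    by (subst P_eq) (simp add: qHermite_eq_poly poly_sum mult_ac)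
qed

end

section \<open>Functions that are rational near the origin\<close>

text \<open>Equality is required at the origin as well, since \<^const>\<open>qderiv\<close> at \<open>0\<close> is an ordinary derivative
  and the values of iterated \<open>q\<close>-derivatives there have to be controlled.\<close>
definition rational_at_0 :: "(real \<Rightarrow> real) \<Rightarrow> bool" where
  "rational_at_0 f \<longleftrightarrow>
     (\<exists>p r. poly r 0 \<noteq> 0 \<and> (\<forall>\<^sub>F x in nhds 0. f x = poly p x / poly r x))"

lemma eventually_poly_nonzero:
  fixes r :: "real poly"
  assumes "poly r 0 \<noteq> 0"
  shows "\<forall>\<^sub>F x in nhds 0. poly r x \<noteq> 0"
proof -
  have "isCont (poly r) 0" by simp
  then have "(poly r \<longlongrightarrow> poly r 0) (nhds 0)"
    by (simp add: isCont_def tendsto_at_iff_tendsto_nhds)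
  then show ?thesis using assms by (rule tendsto_imp_eventually_ne)
qed

lemma rational_at_0_poly_divide: "poly r 0 \<noteq> 0 \<Longrightarrow> rational_at_0 (\<lambda>x. poly p x / poly r x)"
  unfolding rational_at_0_def by (intro exI[of _ p] exI[of _ r]) simp

lemma rational_at_0_poly: "rational_at_0 (poly p)"
  unfolding rational_at_0_def by (rule exI[of _ p], rule exI[of _ 1]) simp

lemma rational_at_0_const: "rational_at_0 (\<lambda>x. c)"
  by (rule back_subst[of rational_at_0, OF rational_at_0_poly[of "[:c:]"]]) (simp add: fun_eq_iff)

lemma rational_at_0_id: "rational_at_0 (\<lambda>x. x)"
  by (rule back_subst[of rational_at_0, OF rational_at_0_poly[of "[:0, 1:]"]]) (simp add: fun_eq_iff)

lemma rational_at_0_add: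
  assumes "rational_at_0 f" "rational_at_0 g"
  shows "rational_at_0 (\<lambda>x. f x + g x)"
proof -
  from assms obtain p r p' r' where r: "poly r 0 \<noteq> 0" "poly r' 0 \<noteq> 0"
    and f: "\<forall>\<^sub>F x in nhds 0. f x = poly p x / poly r x"
    and g: "\<forall>\<^sub>F x in nhds 0. g x = poly p' x / poly r' x"
    unfolding rational_at_0_def by blast
  have "\<forall>\<^sub>F x in nhds 0. f x + g x = poly (p * r' + p' * r) x / poly (r * r') x"
    using f g eventually_poly_nonzero[OF r(1)] eventually_poly_nonzero[OF r(2)]
    by eventually_elim (simp add: field_simps)
  moreover have "poly (r * r') 0 \<noteq> 0" using r by simp
  ultimately show ?thesis unfolding rational_at_0_def by blast
qed

lemma rational_at_0_mult:
  assumes "rational_at_0 f" "rational_at_0 g"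
  shows "rational_at_0 (\<lambda>x. f x * g x)"
proof -
  from assms obtain p r p' r' where r: "poly r 0 \<noteq> 0" "poly r' 0 \<noteq> 0"
    and f: "\<forall>\<^sub>F x in nhds 0. f x = poly p x / poly r x"
    and g: "\<forall>\<^sub>F x in nhds 0. g x = poly p' x / poly r' x"
    unfolding rational_at_0_def by blast
  have "\<forall>\<^sub>F x in nhds 0. f x * g x = poly (p * p') x / poly (r * r') x"
    using f g by eventually_elim simp
  moreover have "poly (r * r') 0 \<noteq> 0" using r by simp
  ultimately show ?thesis unfolding rational_at_0_def by blast
qed

lemma rational_at_0_uminus:
  assumes "rational_at_0 f"
  shows "rational_at_0 (\<lambda>x. - f x)"
  using rational_at_0_mult[OF rational_at_0_const[of "-1"] assms] by simp

lemma rational_at_0_diff: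
  assumes "rational_at_0 f" "rational_at_0 g"
  shows "rational_at_0 (\<lambda>x. f x - g x)"
  using rational_at_0_add[OF assms(1) rational_at_0_uminus[OF assms(2)]] by simp

text \<open>Transfers an identity from nonzero points to the origin by continuity.\<close>
lemma rational_at_0_eq_0:
  assumes "rational_at_0 f" and "\<forall>\<^sub>F x in at 0. f x = 0"
  shows "f 0 = 0"
proof -
  from assms(1) obtain p r where r: "poly r 0 \<noteq> 0"
    and f: "\<forall>\<^sub>F x in nhds 0. f x = poly p x / poly r x"
    unfolding rational_at_0_def by blast
  have "\<forall>\<^sub>F x in at 0. poly p x / poly r x = 0"
    using assms(2) eventually_nhds_x_imp_x[OF f] f
    by (auto simp: eventually_at_filter elim: eventually_elim2)
  then have "((\<lambda>x. poly p x / poly r x) \<longlongrightarrow> 0) (at 0)"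
    by (rule tendsto_eventually)
  moreover have "((\<lambda>x. poly p x / poly r x) \<longlongrightarrow> poly p 0 / poly r 0) (at 0)"
    using r by (intro tendsto_intros)
  ultimately have "poly p 0 / poly r 0 = 0"
    by (intro tendsto_unique[of "at (0::real)"]) auto
  then show ?thesis using eventually_nhds_x_imp_x[OF f] by simp
qed

context q_in_unit_interval begin

lemma eventually_scale:
  assumes "\<forall>\<^sub>F x in nhds 0. Q x"
  shows "\<forall>\<^sub>F x in nhds 0. Q (q * x)"
proof -
  have "((\<lambda>x. q * x) \<longlongrightarrow> q * 0) (at 0)" by (intro tendsto_intros)
  then have "filterlim (\<lambda>x. q * x) (nhds 0) (nhds 0)"
    unfolding tendsto_at_iff_tendsto_nhds by simp
  then show ?thesis using assms by (simp add: filterlim_iff)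
qed

lemma rational_at_0_scale:
  assumes "rational_at_0 f"
  shows "rational_at_0 (\<lambda>x. f (q * x))"
proof -
  from assms obtain p r where r: "poly r 0 \<noteq> 0"
    and f: "\<forall>\<^sub>F x in nhds 0. f x = poly p x / poly r x"
    unfolding rational_at_0_def by blast
  have "\<forall>\<^sub>F x in nhds 0. f (q * x) = poly (p \<circ>\<^sub>p [:0, q:]) x / poly (r \<circ>\<^sub>p [:0, q:]) x"
    using eventually_scale[OF f] by eventually_elim (simp add: poly_pcompose mult.commute)
  moreover have "poly (r \<circ>\<^sub>p [:0, q:]) 0 \<noteq> 0" using r by (simp add: poly_pcompose)
  ultimately show ?thesis unfolding rational_at_0_def by blast
qed

text \<open>The quotient rule for \<open>D\<^sub>q\<close> gives a rational function with denominator \<open>r(x) r(q x)\<close>, and at the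
  origin it reduces to the ordinary quotient rule.\<close>
lemma rational_at_0_qderiv:
  assumes "rational_at_0 f"
  shows "rational_at_0 (qderiv q f)"
proof -
  from assms obtain p r where r: "poly r 0 \<noteq> 0"
    and f: "\<forall>\<^sub>F x in nhds 0. f x = poly p x / poly r x"
    unfolding rational_at_0_def by blast
  let ?n = "poly_qderiv p * r - p * poly_qderiv r" and ?d = "r * (r \<circ>\<^sub>p [:0, q:])"
  have rq: "\<forall>\<^sub>F x in nhds 0. poly r (q * x) \<noteq> 0"
    by (rule eventually_scale[OF eventually_poly_nonzero[OF r]])
  have d0: "deriv f 0 = poly ?n 0 / poly ?d 0"
  proof -
    have "((\<lambda>x. poly p x / poly r x) has_real_derivative
        (poly (pderiv p) 0 * poly r 0 - poly p 0 * poly (pderiv r) 0) / (poly r 0 * poly r 0)) (at 0)"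
      using r by (intro DERIV_divide poly_DERIV)
    then have "(f has_real_derivative
        (poly (pderiv p) 0 * poly r 0 - poly p 0 * poly (pderiv r) 0) / (poly r 0 * poly r 0)) (at 0)"
      by (subst DERIV_cong_ev[OF refl f refl])
    then show ?thesis
      by (simp add: DERIV_imp_deriv poly_qderiv_at_0 poly_pcompose)
  qed
  have "\<forall>\<^sub>F x in nhds 0. qderiv q f x = poly ?n x / poly ?d x"
    using f eventually_scale[OF f] eventually_poly_nonzero[OF r] rq
  proof eventually_elim
    case (elim x)
    show ?case
    proof (cases "x = 0")
      case True
      then show ?thesis by (simp add: qderiv_def d0)
    next
      case False
      define P P' R R' where "P = poly p x" and "P' = poly (poly_qderiv p) x"
        and "R = poly r x" and "R' = poly (poly_qderiv r) x"
      have e: "poly p (q * x) = P + (q - 1) * x * P'" "poly r (q * x) = R + (q - 1) * x * R'"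
        using poly_qderiv_spec_at[of x p] poly_qderiv_spec_at[of x r]
        by (auto simp: P_def P'_def R_def R'_def)
      define S where "S = R + (q - 1) * x * R'"
      have nz: "R \<noteq> 0" "S \<noteq> 0" using elim(3,4) by (auto simp: R_def S_def e)
      have k: "(q - 1) * x \<noteq> 0" using False q_less_1 by simp
      have "qderiv q f x = ((P + (q - 1) * x * P') / S - P / R) / ((q - 1) * x)"
        using False elim(1,2) unfolding e S_def[symmetric]
        by (simp add: qderiv_def P_def[symmetric] R_def[symmetric])
      also have "(P + (q - 1) * x * P') / S - P / R = ((P + (q - 1) * x * P') * R - P * S) / (S * R)"
        using nz by (simp add: diff_frac_eq)
      also have "(P + (q - 1) * x * P') * R - P * S = ((q - 1) * x) * (P' * R - P * R')"
        unfolding S_def by (simp add: algebra_simps)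
      also have "((q - 1) * x) * (P' * R - P * R') / (S * R) / ((q - 1) * x) = (P' * R - P * R') / (R * S)"
        using k nz by (simp add: mult.commute)
      also have "\<dots> = poly ?n x / poly ?d x"
        using e(2) by (simp add: poly_pcompose P_def P'_def R_def R'_def S_def mult.commute[of x q])
      finally show ?thesis .
    qed
  qed
  moreover have "poly ?d 0 \<noteq> 0" using r by (simp add: poly_pcompose)
  ultimately show ?thesis unfolding rational_at_0_def by blast
qed

definition qsub_poly :: "real \<Rightarrow> nat \<Rightarrow> real poly" where
  "qsub_poly y m = (\<Prod>i<m. [:- (q ^ i * y), 1:])"

lemma poly_qsub_poly: "poly (qsub_poly y m) x = qsub_pow q x y m"
  by (simp add: qsub_poly_def qsub_pow_eq_prod poly_prod)

lemma qsub_pow_0_nonzero: "y \<noteq> 0 \<Longrightarrow> qsub_pow q 0 y m \<noteq> 0"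
  using q_pos by (simp add: qsub_pow_eq_prod)

lemma rational_at_0_qsub_ratio:
  assumes "y \<noteq> 0"
  shows "rational_at_0 (\<lambda>x. c / (N * qsub_pow q x y m) * (\<Sum>k\<le>j. d k * qsub_pow q x y k))"
proof -
  have "rational_at_0 (\<lambda>x. c * inverse N * (poly (\<Sum>k\<le>j. smult (d k) (qsub_poly y k)) x / poly (qsub_poly y m) x))"
    by (intro rational_at_0_mult[OF rational_at_0_const] rational_at_0_poly_divide)
       (simp add: poly_qsub_poly qsub_pow_0_nonzero[OF assms])
  then show ?thesis
    by (simp add: poly_sum poly_qsub_poly field_simps)
qed

lemma rational_at_0_Acoef: "y \<noteq> 0 \<Longrightarrow> rational_at_0 (\<lambda>x. Acoef q j n x y)"
  unfolding Acoef_def by (rule rational_at_0_qsub_ratio)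

lemma rational_at_0_Bcoef: "y \<noteq> 0 \<Longrightarrow> rational_at_0 (\<lambda>x. Bcoef q j n x y)"
  unfolding Bcoef_def mult_minus_left by (intro rational_at_0_uminus rational_at_0_qsub_ratio)

lemmas rational_at_0_basic = rational_at_0_const rational_at_0_id rational_at_0_add rational_at_0_diff
  rational_at_0_uminus rational_at_0_mult rational_at_0_Acoef rational_at_0_Bcoef

lemma rational_at_0_C1: "y \<noteq> 0 \<Longrightarrow> rational_at_0 (\<lambda>x. C1 q j n x y)"
  unfolding C1_def
  by (intro rational_at_0_basic rational_at_0_qderiv
      rational_at_0_scale[of "\<lambda>x. Bcoef q j n x y"])

lemma rational_at_0_D1: "y \<noteq> 0 \<Longrightarrow> rational_at_0 (\<lambda>x. D1 q j n x y)"
  unfolding D1_def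
  by (intro rational_at_0_basic rational_at_0_qderiv
      rational_at_0_scale[of "\<lambda>x. Acoef q j n x y"] rational_at_0_scale[of "\<lambda>x. Bcoef q j n x y"])

lemma rational_at_0_C2: "y \<noteq> 0 \<Longrightarrow> rational_at_0 (\<lambda>x. C2 q j n x y)"
  unfolding C2_def
  by (intro rational_at_0_basic rational_at_0_C1 rational_at_0_qderiv
      rational_at_0_scale[of "\<lambda>x. D1 q j n x y"] rational_at_0_D1)

lemma rational_at_0_D2: "y \<noteq> 0 \<Longrightarrow> rational_at_0 (\<lambda>x. D2 q j n x y)"
  unfolding D2_def
  by (intro rational_at_0_basic rational_at_0_D1 rational_at_0_qderiv
      rational_at_0_scale[of "\<lambda>x. C1 q j n x y"] rational_at_0_scale[of "\<lambda>x. D1 q j n x y"]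
      rational_at_0_C1)

section \<open>Differentiating combinations of two consecutive q-Hermite polynomials\<close>

text \<open>The product rule \<open>D\<^sub>q(f g)(x) = f(q x) (D\<^sub>q g)(x) + g(x) (D\<^sub>q f)(x)\<close>, with \<open>D\<^sub>q H\<^sub>n = [n] H\<^sub>n\<^sub>-\<^sub>1\<close> and
  \<open>\<gamma>\<^sub>n H\<^sub>n\<^sub>-\<^sub>1 = x H\<^sub>n - H\<^sub>n\<^sub>+\<^sub>1\<close>, keeps the result in the span of \<open>H\<^sub>n\<^sub>+\<^sub>1\<close> and \<open>H\<^sub>n\<close>. Its coefficients have
  the pattern by which \<^const>\<open>C1\<close>, \<^const>\<open>D1\<close> arise from \<^const>\<open>Acoef\<close>, \<^const>\<open>Bcoef\<close> and
  \<^const>\<open>C2\<close>, \<^const>\<open>D2\<close> from \<^const>\<open>C1\<close>, \<^const>\<open>D1\<close>.\<close>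
lemma qderiv_hermite_combination:
  fixes E F f :: "real \<Rightarrow> real" and n :: nat
  defines "a \<equiv> poly (hermite_poly (Suc n))" and "b \<equiv> poly (hermite_poly n)"
    and "\<mu> \<equiv> qnum q (int n) / gam q (int n)"
  assumes x: "x \<noteq> 0"
    and f: "f x = E x * a x + F x * b x" "f (q * x) = E (q * x) * a (q * x) + F (q * x) * b (q * x)"
  shows "qderiv q f x = (qderiv q E x - \<mu> * F (q * x)) * a x
     + (qnum q (int (Suc n)) * E (q * x) + \<mu> * x * F (q * x) + qderiv q F x) * b x"
proof -
  define k N where "k = (q - 1) * x" and "N = qnum q (int (Suc n))"
  have k: "k \<noteq> 0" using x q_less_1 by (simp add: k_def)
  have a: "a (q * x) = a x + k * (N * b x)"
    using poly_qderiv_spec_at[of x "hermite_poly (Suc n)"]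
    by (simp add: poly_qderiv_hermite a_def b_def k_def N_def del: hermite_poly.simps of_nat_Suc)
  \<comment> \<open>for \<open>n = 0\<close> the coefficient \<open>[0] / \<gamma>\<^sub>0\<close> is \<open>0 / 0 = 0\<close>, in agreement with \<open>D\<^sub>q H\<^sub>0 = 0\<close>\<close>
  have "qnum q (int n) * poly (hermite_poly (n - 1)) x = \<mu> * (x * b x - a x)"
  proof (cases n)
    case 0
    then show ?thesis by (simp add: \<mu>_def qnum_def)
  next
    case (Suc m)
    have "poly ([:0, 1:] * hermite_poly n) x
        = poly (hermite_poly (Suc n) + smult (gam q (int n)) (hermite_poly (n - 1))) x"
      by (simp only: hermite_recurrence)
    then have "x * b x - a x = gam q (int n) * poly (hermite_poly (n - 1)) x"
      by (simp add: a_def b_def del: hermite_poly.simps)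
    then show ?thesis using gam_Suc_pos[of m] Suc by (simp add: \<mu>_def)
  qed
  then have b: "b (q * x) = b x + k * (\<mu> * (x * b x - a x))"
    using poly_qderiv_spec_at[of x "hermite_poly n"]
    by (simp add: poly_qderiv_hermite b_def k_def del: hermite_poly.simps)
  have Ex: "E (q * x) = E x + k * qderiv q E x" and Fx: "F (q * x) = F x + k * qderiv q F x"
    using x k by (auto simp: qderiv_def k_def)
  have "k * qderiv q f x = f (q * x) - f x"
    using x k by (simp add: qderiv_def k_def)
  also have "\<dots> = k * ((qderiv q E x - \<mu> * F (q * x)) * a x
     + (N * E (q * x) + \<mu> * x * F (q * x) + qderiv q F x) * b x)"
    unfolding f a b
    by (simp add: Ex Fx algebra_simps)
  finally show ?thesis using k by (simp add: N_def)
qed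

lemma qderiv_affine: "x \<noteq> 0 \<Longrightarrow> qderiv q (\<lambda>t. u - c * g t) x = - c * qderiv q g x"
  using q_less_1 by (simp add: qderiv_def divide_simps) (simp add: algebra_simps)

lemma qfall_2: "qfall q n 2 = qnum q n * qnum q (n - 1)"
proof -
  have "qfall q n 0 = 1" by (simp add: qfall_def qpoch_def numeral_2_eq_2)
  then show ?thesis
    using qfall_Suc[of n 0] qfall_Suc[of n 1] by (simp add: numeral_2_eq_2)
qed

context
  fixes \<alpha> lam :: real and j :: nat and P :: "nat \<Rightarrow> real poly" and n :: nat
  assumes alpha: "\<alpha> \<noteq> 0" and lam: "lam > 0" and P: "sobolev_polys q \<alpha> lam j P"
begin

lemma sobolev_rep:
  assumes "qsub_pow q x \<alpha> (j + 1) \<noteq> 0"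
  shows "poly (P (Suc n)) x = E1 q \<alpha> lam j (int (Suc n)) x * poly (hermite_poly (Suc n)) x + F1 q \<alpha> lam j (int (Suc n)) x * poly (hermite_poly n) x"
  unfolding sobolev_connection[OF lam P] kernel_eq_coefs[OF assms] qHermite_eq_poly E1_def F1_def
  by (simp add: algebra_simps del: hermite_poly.simps of_nat_Suc)

lemma eventually_denom: "\<forall>\<^sub>F x in nhds 0. qsub_pow q x \<alpha> (j + 1) \<noteq> 0"
  using eventually_poly_nonzero[of "qsub_poly \<alpha> (j + 1)"] qsub_pow_0_nonzero[OF alpha]
  by (simp add: poly_qsub_poly)

lemma int_Suc_minus_1: "int (Suc n) - 1 = int n" by simp

lemma qderiv_sobolev_rep_nonzero:
  assumes "qsub_pow q x \<alpha> (j + 1) \<noteq> 0" "qsub_pow q (q * x) \<alpha> (j + 1) \<noteq> 0" "x \<noteq> 0"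
  shows "qderiv q (poly (P (Suc n))) x
     = E3 q \<alpha> lam j (int (Suc n)) x * poly (hermite_poly (Suc n)) x + F3 q \<alpha> lam j (int (Suc n)) x * poly (hermite_poly n) x"
proof -
  let ?c = "ccoef q \<alpha> lam j (int (Suc n))"
  have E: "qderiv q (E1 q \<alpha> lam j (int (Suc n))) x = - ?c * qderiv q (\<lambda>t. Acoef q j (int (Suc n)) t \<alpha>) x"
    unfolding E1_def[abs_def] by (rule qderiv_affine[OF assms(3)])
  have F: "qderiv q (F1 q \<alpha> lam j (int (Suc n))) x = - ?c * qderiv q (\<lambda>t. Bcoef q j (int (Suc n)) t \<alpha>) x"
    using qderiv_affine[OF assms(3), of 0 ?c] by (simp add: F1_def[abs_def])
  show ?thesis
    unfolding qderiv_hermite_combination[of x "poly (P (Suc n))", OF assms(3) sobolev_rep[OF assms(1)]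
        sobolev_rep[OF assms(2)]] E F
    unfolding E3_def F3_def C1_def D1_def E1_def F1_def int_Suc_minus_1
    by (simp add: algebra_simps del: hermite_poly.simps of_nat_Suc)
qed

lemma qderiv_sobolev_rep:
  assumes "qsub_pow q x \<alpha> (j + 1) \<noteq> 0" "qsub_pow q (q * x) \<alpha> (j + 1) \<noteq> 0"
  shows "qderiv q (poly (P (Suc n))) x
     = E3 q \<alpha> lam j (int (Suc n)) x * poly (hermite_poly (Suc n)) x + F3 q \<alpha> lam j (int (Suc n)) x * poly (hermite_poly n) x"
proof (cases "x = 0")
  case True
  let ?g = "\<lambda>x. qderiv q (poly (P (Suc n))) x
     - (E3 q \<alpha> lam j (int (Suc n)) x * poly (hermite_poly (Suc n)) x + F3 q \<alpha> lam j (int (Suc n)) x * poly (hermite_poly n) x)"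
  have "rational_at_0 ?g"
    unfolding E3_def F3_def
    by (intro rational_at_0_basic rational_at_0_C1 rational_at_0_D1 rational_at_0_poly
        rational_at_0_qderiv alpha)
  moreover have "\<forall>\<^sub>F x in at 0. ?g x = 0"
    unfolding eventually_at_filter
    using eventually_denom eventually_scale[OF eventually_denom]
    by eventually_elim (use qderiv_sobolev_rep_nonzero in auto)
  ultimately have "?g 0 = 0" by (rule rational_at_0_eq_0)
  then show ?thesis using True by simp
qed (use qderiv_sobolev_rep_nonzero[OF assms] in blast)

lemma qderiv2_sobolev_rep_nonzero:
  assumes "qsub_pow q x \<alpha> (j + 1) \<noteq> 0" "qsub_pow q (q * x) \<alpha> (j + 1) \<noteq> 0" "qsub_pow q (q * (q * x)) \<alpha> (j + 1) \<noteq> 0" "x \<noteq> 0"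
  shows "qderiv q (qderiv q (poly (P (Suc n)))) x
     = E5 q \<alpha> lam j (int (Suc n)) x * poly (hermite_poly (Suc n)) x + F5 q \<alpha> lam j (int (Suc n)) x * poly (hermite_poly n) x"
proof -
  let ?c = "ccoef q \<alpha> lam j (int (Suc n))"
  have E: "qderiv q (E3 q \<alpha> lam j (int (Suc n))) x = - ?c * qderiv q (\<lambda>t. C1 q j (int (Suc n)) t \<alpha>) x"
    using qderiv_affine[OF assms(4), of 0 ?c] by (simp add: E3_def[abs_def])
  have F: "qderiv q (F3 q \<alpha> lam j (int (Suc n))) x = - ?c * qderiv q (\<lambda>t. D1 q j (int (Suc n)) t \<alpha>) x"
    unfolding F3_def[abs_def] by (rule qderiv_affine[OF assms(4)])
  show ?thesis
    unfolding qderiv_hermite_combination[of x "qderiv q (poly (P (Suc n)))", OF assms(4)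
        qderiv_sobolev_rep[OF assms(1,2)] qderiv_sobolev_rep[OF assms(2,3)]] E F
    unfolding E5_def F5_def C2_def D2_def E3_def F3_def int_Suc_minus_1 qfall_2
    by (simp add: algebra_simps del: hermite_poly.simps of_nat_Suc)
qed

lemma qderiv2_sobolev_rep:
  assumes "qsub_pow q x \<alpha> (j + 1) \<noteq> 0" "qsub_pow q (q * x) \<alpha> (j + 1) \<noteq> 0" "qsub_pow q (q * (q * x)) \<alpha> (j + 1) \<noteq> 0"
  shows "qderiv q (qderiv q (poly (P (Suc n)))) x
     = E5 q \<alpha> lam j (int (Suc n)) x * poly (hermite_poly (Suc n)) x + F5 q \<alpha> lam j (int (Suc n)) x * poly (hermite_poly n) x"
proof (cases "x = 0")
  case True
  let ?g = "\<lambda>x. qderiv q (qderiv q (poly (P (Suc n)))) x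
     - (E5 q \<alpha> lam j (int (Suc n)) x * poly (hermite_poly (Suc n)) x + F5 q \<alpha> lam j (int (Suc n)) x * poly (hermite_poly n) x)"
  have "rational_at_0 ?g"
    unfolding E5_def F5_def
    by (intro rational_at_0_basic rational_at_0_C2 rational_at_0_D2 rational_at_0_poly
        rational_at_0_qderiv alpha)
  moreover have "\<forall>\<^sub>F x in at 0. ?g x = 0"
    unfolding eventually_at_filter
    using eventually_denom eventually_scale[OF eventually_denom]
      eventually_scale[OF eventually_scale[OF eventually_denom]]
    by eventually_elim (use qderiv2_sobolev_rep_nonzero in auto)
  ultimately have "?g 0 = 0" by (rule rational_at_0_eq_0)
  then show ?thesis using True by simp
qed (use qderiv2_sobolev_rep_nonzero[OF assms] in blast)

end

end

section \<open>The second-order q-difference equation\<close>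

theorem theorem2:
  fixes q \<alpha> lam :: real and j :: nat and P :: "nat \<Rightarrow> real poly"
  assumes "0 < q" "q < 1"
    and "\<alpha> \<notin> {-1..1}"
    and "lam > 0"
    and "sobolev_polys q \<alpha> lam j P"
  shows "\<forall>(n::nat) (x::real). coefs_defined q \<alpha> j x \<longrightarrow>
    Rcoef q \<alpha> lam j (int n) x * (qderiv q ^^ 2) (poly (P n)) x
    + Scoef q \<alpha> lam j (int n) x * qderiv q (poly (P n)) x
    + Tcoef q \<alpha> lam j (int n) x * poly (P n) x = 0"
proof (intro allI impI)
  interpret q_in_unit_interval q using assms(1,2) by unfold_locales
  fix n :: nat and x :: real
  assume defined: "coefs_defined q \<alpha> j x"
  have alpha: "\<alpha> \<noteq> 0" using assms(3) by auto
  show "Rcoef q \<alpha> lam j (int n) x * (qderiv q ^^ 2) (poly (P n)) x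
    + Scoef q \<alpha> lam j (int n) x * qderiv q (poly (P n)) x
    + Tcoef q \<alpha> lam j (int n) x * poly (P n) x = 0"
  proof (cases n)
    case 0
    \<comment> \<open>\<open>sqnorm (-1) = 0\<close> makes \<open>A\<close> and \<open>B\<close> vanish; as also \<open>[0] = 0\<close>, so does every coefficient of the equation\<close>
    have z: "(\<lambda>t. 0) = poly (0 :: real poly)" by (simp add: fun_eq_iff)
    have d: "qderiv q (\<lambda>t. 0) = (\<lambda>t. 0)" unfolding z qderiv_poly by simp
    have "Acoef q j 0 t y = 0" "Bcoef q j 0 t y = 0" for t y
      by (simp_all add: Acoef_def Bcoef_def sqnorm_def)
    then have "C1 q j 0 t y = 0" "D1 q j 0 t y = 0" for t y
      by (simp_all add: C1_def D1_def qnum_def d)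
    moreover from this have "C2 q j 0 t y = 0" "D2 q j 0 t y = 0" for t y
      by (simp_all add: C2_def D2_def d)
    ultimately have "E3 q \<alpha> lam j 0 x = 0" "F3 q \<alpha> lam j 0 x = 0" "E5 q \<alpha> lam j 0 x = 0" "F5 q \<alpha> lam j 0 x = 0"
      by (simp_all add: E3_def F3_def E5_def F5_def qfall_2 qnum_def)
    then show ?thesis
      using 0 by (simp add: Rcoef_def Scoef_def Tcoef_def F4_def F6_def)
  next
    case (Suc m)
    let ?a = "poly (hermite_poly (Suc m)) x" and ?b = "poly (hermite_poly m) x"
    have den: "qsub_pow q x \<alpha> (j + 1) \<noteq> 0" "qsub_pow q (q * x) \<alpha> (j + 1) \<noteq> 0"
      "qsub_pow q (q * (q * x)) \<alpha> (j + 1) \<noteq> 0"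
      using defined[unfolded coefs_defined_def, rule_format, of 0]
        defined[unfolded coefs_defined_def, rule_format, of 1]
        defined[unfolded coefs_defined_def, rule_format, of 2]
      by (simp_all add: power2_eq_square mult.assoc)
    have d2: "(qderiv q ^^ 2) (poly (P n)) x = qderiv q (qderiv q (poly (P n))) x"
      by (simp add: numeral_2_eq_2)
    show ?thesis
      unfolding d2 unfolding Suc
        qderiv2_sobolev_rep[OF alpha assms(4,5) den] qderiv_sobolev_rep[OF alpha assms(4,5) den(1,2)]
        sobolev_rep[OF alpha assms(4,5) den(1)]
        Rcoef_def Scoef_def Tcoef_def Xi1_def E4_def F4_def E6_def F6_def
      \<comment> \<open>Cramer's rule and elimination, as one polynomial identity in \<open>H\<^sub>n\<close>, \<open>H\<^sub>n\<^sub>-\<^sub>1\<close> and the coefficients\<close>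
      by algebra
  qed
qed

end
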